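(* Let $P$ and $Q$ be lattice paths from $(0,0)$ to $(m,r)$ with steps $E=(1,0)$, $N=(0,1)$, $P$ never above $Q$, such that $\mathcal{M}[P,Q]$ is a connected lattice path matroid of rank $r$ on $\{1,\dots,m+r\}$ that is not a border strip matroid. Then the normalized volume of $\mathcal{P}(\mathcal{M}[P,Q])$ equals $\sum_p f_{S(p)}$, where $p$ ranges over all border strips contained in the region between $P$ and $Q$ and $f_{S(p)}$ is the number of standard Young tableaux of shape $S(p)$.
   Context: $\mathcal{M}[P,Q]$ is the matroid on $[m+r]$ whose bases are the $r$-subsets $B$ such that the lattice path with North steps exactly at the positions in $B$ stays in the region bounded by $P$ and $Q$; it is connected iff $P$ and $Q$ meet only at $(0,0)$ and $(m,r)$. $\mathcal{P}(\mathcal{M})=\mathrm{conv}\{\sum_{i\in B}e_i : B\text{ a basis}\}$. A border strip $p$ is a sequence of $m+r-1$ unit boxes from the box with lower-left corner $(0,0)$ to the box with upper-right corner $(m,r)$, each box immediately right of or immediately above the previous one; it is contained in the region between $P$ and $Q$ if all its boxes lie there. $S(p)$ denotes the lattice path matroid whose region is exactly $p$, and $\mathcal{M}[P,Q]$ is a border strip matroid if its region is itself a border strip. A standard Young tableau of shape $S(p)$ is a bijective filling of the boxes with $1,\dots,m+r-1$ increasing from left to right along rows and decreasing from bottom to top along columns. Normalized volume: project the polytope (which lies in $x_1+\dots+x_{m+r}=r$) to $\mathbb{R}^{m+r-1}$ by forgetting the last coordinate and take $(m+r-1)!$ times the Euclidean volume. *)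

theory Defs
  imports "HOL-Analysis.Analysis" "HOL-Analysis.Finite_Function_Topology"
begin

text \<open>
  Only the data of a matroid: the record does not include the basis exchange axiom, which the lattice
  path families below satisfy.
\<close>

record 'a matroid =
  ground :: "'a set"
  bases :: "'a set set"

definition indep :: "'a matroid \<Rightarrow> 'a set \<Rightarrow> bool" where
  "indep M X \<longleftrightarrow> (\<exists>B \<in> bases M. X \<subseteq> B)"

definition circuit :: "'a matroid \<Rightarrow> 'a set \<Rightarrow> bool" where
  "circuit M C \<longleftrightarrow> C \<subseteq> ground M \<and> \<not> indep M C \<and> (\<forall>D. D \<subset> C \<longrightarrow> indep M D)"

definition matroid_connected :: "'a matroid \<Rightarrow> bool" where
  "matroid_connected M \<longleftrightarrow>
     (\<forall>x \<in> ground M. \<forall>y \<in> ground M. x \<noteq> y \<longrightarrow> (\<exists>C. circuit M C \<and> x \<in> C \<and> y \<in> C))"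

text \<open>
  A vector is a finitely supported function \<open>nat \<Rightarrow>\<^sub>0 real\<close>; only the coordinates in the ground
  set are nonzero on the polytope.
\<close>

definition matroid_polytope :: "nat matroid \<Rightarrow> (nat \<Rightarrow>\<^sub>0 real) set" where
  "matroid_polytope M = convex hull ((\<lambda>B. \<Sum>i\<in>B. Poly_Mapping.single i 1) ` bases M)"

text \<open>
  For \<open>S\<close> in the coordinates \<open>1, \<dots>, n\<close>: forget coordinate \<open>n\<close> and measure the image in
  \<open>\<real>\<^sup>n\<^sup>-\<^sup>1\<close>, modelled by the product of \<open>n - 1\<close> copies of Lebesgue-Borel measure.
\<close>

definition normalized_volume :: "nat \<Rightarrow> (nat \<Rightarrow>\<^sub>0 real) set \<Rightarrow> real" where
  "normalized_volume n S =
     fact (n - 1) *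
     measure (Pi\<^sub>M {1..<n} (\<lambda>_. lborel)) ((\<lambda>x. restrict (Poly_Mapping.lookup x) {1..<n}) ` S)"


datatype step = E | N

definition lattice_path :: "nat \<Rightarrow> nat \<Rightarrow> step list \<Rightarrow> bool" where
  "lattice_path m r w \<longleftrightarrow> count_list w E = m \<and> count_list w N = r"

definition vertex :: "step list \<Rightarrow> nat \<Rightarrow> nat \<times> nat" where
  "vertex w k = (count_list (take k w) E, count_list (take k w) N)"

definition never_above :: "step list \<Rightarrow> step list \<Rightarrow> bool" where
  "never_above P Q \<longleftrightarrow> (\<forall>k \<le> length P. snd (vertex P k) \<le> snd (vertex Q k))"

text \<open>
  The lattice points of the region bounded by \<open>P\<close> (below) and \<open>Q\<close> (above).  A point \<open>(x, y)\<close> is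
  compared with the points where \<open>P\<close> and \<open>Q\<close> cross its antidiagonal, which they reach after
  \<open>x + y\<close> steps.
\<close>

definition region_points :: "step list \<Rightarrow> step list \<Rightarrow> (nat \<times> nat) set" where
  "region_points P Q =
     {(x, y). x + y \<le> length P \<and> snd (vertex P (x + y)) \<le> y \<and> y \<le> snd (vertex Q (x + y))}"

text \<open>
  A unit box is named by its lower-left corner.  Since the boundary paths consist of unit lattice
  steps, a box lies in the region exactly when its four corners do.
\<close>

definition region_boxes :: "step list \<Rightarrow> step list \<Rightarrow> (nat \<times> nat) set" where
  "region_boxes P Q = {(i, j). {i, i + 1} \<times> {j, j + 1} \<subseteq> region_points P Q}"

definition path_of_set :: "nat \<Rightarrow> nat set \<Rightarrow> step list" where
  "path_of_set n B = map (\<lambda>i. if i \<in> B then N else E) [1..<n + 1]"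

definition lattice_path_matroid :: "nat \<Rightarrow> nat \<Rightarrow> step list \<Rightarrow> step list \<Rightarrow> nat matroid" where
  "lattice_path_matroid m r P Q =
     \<lparr>ground = {1..m + r},
      bases = {B. B \<subseteq> {1..m + r} \<and> card B = r \<and>
                  (\<forall>k \<le> m + r. vertex (path_of_set (m + r) B) k \<in> region_points P Q)}\<rparr>"


text \<open>
  In the degenerate case \<open>m + r \<le> 1\<close> there are no boxes, and the empty sequence counts as a
  border strip.
\<close>

definition border_strip :: "nat \<Rightarrow> nat \<Rightarrow> (nat \<times> nat) list \<Rightarrow> bool" where
  "border_strip m r p \<longleftrightarrow>
     length p = m + r - 1 \<and>
     (p \<noteq> [] \<longrightarrow> hd p = (0, 0) \<and> map_prod Suc Suc (last p) = (m, r)) \<and>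
     (\<forall>k. Suc k < length p \<longrightarrow>
        p ! Suc k = map_prod Suc id (p ! k) \<or> p ! Suc k = map_prod id Suc (p ! k))"

definition border_strips_in :: "nat \<Rightarrow> nat \<Rightarrow> step list \<Rightarrow> step list \<Rightarrow> (nat \<times> nat) list set" where
  "border_strips_in m r P Q = {p. border_strip m r p \<and> set p \<subseteq> region_boxes P Q}"

definition border_strip_matroid :: "nat \<Rightarrow> nat \<Rightarrow> step list \<Rightarrow> step list \<Rightarrow> bool" where
  "border_strip_matroid m r P Q \<longleftrightarrow> (\<exists>p. border_strip m r p \<and> set p = region_boxes P Q)"

text \<open>
  Rows share the second coordinate, columns the first.  Fillings are extensional, so that each
  filling of the shape \<open>D\<close> is represented by exactly one function.
\<close>

definition standard_young_tableaux :: "(nat \<times> nat) set \<Rightarrow> (nat \<times> nat \<Rightarrow> nat) set" where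
  "standard_young_tableaux D =
     {T \<in> extensional D. bij_betw T D {1..card D} \<and>
        (\<forall>i i' j. (i, j) \<in> D \<and> (i', j) \<in> D \<and> i < i' \<longrightarrow> T (i, j) < T (i', j)) \<and>
        (\<forall>i j j'. (i, j) \<in> D \<and> (i, j') \<in> D \<and> j < j' \<longrightarrow> T (i, j) > T (i, j'))}"

end

theory Submission
  imports Defs "HOL-Combinatorics.Permutations"
begin

text \<open>
  In the coordinates \<open>s k = x 1 + \<dots> + x k\<close>, a unimodular change of variables, the polytope consists
  of the real height profiles lying between \<open>P\<close> and \<open>Q\<close> whose steps are in \<open>[0, 1]\<close>.  Almost every
  profile has nonzero and pairwise distinct fractional parts.  Let \<open>\<tau> k\<close> be the rank of the
  fractional part of \<open>s k\<close>.  A step in \<open>[0, 1]\<close> raises the integer part by one exactly when the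
  fractional part drops, so the integer part of \<open>s k\<close> is the number of descents of \<open>\<tau>\<close> before \<open>k\<close>,
  and each \<open>\<tau>\<close> contributes either nothing or a translated order simplex of volume \<open>1 / (n - 1)!\<close>.  The
  integer parts trace a border strip, going up at each descent, and the permutations that trace a
  given strip are its standard Young tableaux read along the strip.
\<close>

subsection \<open>The polytope as a set of height profiles\<close>

text \<open>A step in \<open>[0, 1]\<close> sees fractional parts only through their order, and the
  bounds coming from the paths are integers. This is used twice. Fractional parts can be merged
  without leaving the set of profiles, which exhibits every profile as a convex combination of
  integral ones and hence of basis vectors. And generic profiles whose fractional parts are ordered
  alike have the same integer parts. Dropping the last coordinate fits the profiles, since
  \<open>s n = r\<close> is fixed; this integer end in turn forces exactly \<open>r - 1\<close>
  descents. The factor \<open>1 / (n - 1)!\<close> of each simplex cancels the normalization, so the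
  volume becomes a count of permutations. Containment of a strip in the region matches the path
  bounds on a profile: a strip box with lower-left corner at height \<open>d\<close> on antidiagonal
  \<open>k - 1\<close> lies in the region exactly when the interval from \<open>d\<close> to
  \<open>d + 1\<close> lies between the heights of \<open>P\<close> and \<open>Q\<close> at
  \<open>k\<close>.\<close>

definition height :: "step list \<Rightarrow> nat \<Rightarrow> nat" where
  "height w k = count_list (take k w) N"

definition height_profile ::
    "nat \<Rightarrow> nat \<Rightarrow> (nat \<Rightarrow> nat) \<Rightarrow> (nat \<Rightarrow> nat) \<Rightarrow> (nat \<Rightarrow> real) \<Rightarrow> bool" where
  "height_profile n r p q s \<longleftrightarrow>
     s 0 = 0 \<and> s n = real r \<and>
     (\<forall>k<n. 0 \<le> s (Suc k) - s k \<and> s (Suc k) - s k \<le> 1) \<and>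
     (\<forall>k\<le>n. real (p k) \<le> s k \<and> s k \<le> real (q k))"

definition increments :: "nat \<Rightarrow> (nat \<Rightarrow> real) \<Rightarrow> (nat \<Rightarrow>\<^sub>0 real)" where
  "increments n s = (\<Sum>i=1..n. Poly_Mapping.single i (s i - s (i - 1)))"

lemma lookup_increments:
  "Poly_Mapping.lookup (increments n s) i = (if i \<in> {1..n} then s i - s (i - 1) else 0)"
  unfolding increments_def lookup_sum
  by (auto simp: lookup_single when_def sum.delta)

lemma lookup_scaleR: "Poly_Mapping.lookup (c *\<^sub>R x) i = c *\<^sub>R Poly_Mapping.lookup x i"
proof -
  have "finite {i. c *\<^sub>R Poly_Mapping.lookup x i \<noteq> 0}"
    by (rule finite_subset[OF _ finite_lookup[of x]]) auto
  then show ?thesis by (simp add: scaleR_poly_mapping_def)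
qed

lemma increments_convex_combination:
  "increments n (\<lambda>k. u * s k + v * t k) = u *\<^sub>R increments n s + v *\<^sub>R increments n t"
  by (rule poly_mapping_eqI) (simp add: lookup_increments lookup_add lookup_scaleR algebra_simps)

text \<open>\<open>y - x\<close> is the difference of the integer parts plus that of the fractional
  parts, and the latter lies strictly between -1 and 1. For each of the two possible jumps of the
  integer part, the condition becomes a mere comparison of fractional parts.\<close>

lemma step_iff_floor_frac:
  fixes x y :: real
  shows "0 \<le> y - x \<and> y - x \<le> 1 \<longleftrightarrow>
    (\<lfloor>y\<rfloor> = \<lfloor>x\<rfloor> \<and> frac x \<le> frac y) \<or> (\<lfloor>y\<rfloor> = \<lfloor>x\<rfloor> + 1 \<and> frac y \<le> frac x)"
proof -
  have *: "x = of_int \<lfloor>x\<rfloor> + frac x" "y = of_int \<lfloor>y\<rfloor> + frac y" "0 \<le> frac x" "frac x < 1"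
    "0 \<le> frac y" "frac y < 1"
    by (auto simp: frac_lt_1) (auto simp: frac_def)
  show ?thesis
  proof
    assume A: "0 \<le> y - x \<and> y - x \<le> 1"
    have "real_of_int \<lfloor>y\<rfloor> - \<lfloor>x\<rfloor> > -1" "real_of_int \<lfloor>y\<rfloor> - \<lfloor>x\<rfloor> < 2"
      using A * by linarith+
    then have "\<lfloor>y\<rfloor> = \<lfloor>x\<rfloor> \<or> \<lfloor>y\<rfloor> = \<lfloor>x\<rfloor> + 1" by linarith
    then show "(\<lfloor>y\<rfloor> = \<lfloor>x\<rfloor> \<and> frac x \<le> frac y) \<or> (\<lfloor>y\<rfloor> = \<lfloor>x\<rfloor> + 1 \<and> frac y \<le> frac x)"
      using A * by (auto simp: frac_def)
  next
    assume "(\<lfloor>y\<rfloor> = \<lfloor>x\<rfloor> \<and> frac x \<le> frac y) \<or> (\<lfloor>y\<rfloor> = \<lfloor>x\<rfloor> + 1 \<and> frac y \<le> frac x)"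
    then show "0 \<le> y - x \<and> y - x \<le> 1"
    proof
      assume A: "\<lfloor>y\<rfloor> = \<lfloor>x\<rfloor> \<and> frac x \<le> frac y"
      then have "real_of_int \<lfloor>y\<rfloor> = \<lfloor>x\<rfloor>" by simp
      with A * show ?thesis by linarith
    next
      assume A: "\<lfloor>y\<rfloor> = \<lfloor>x\<rfloor> + 1 \<and> frac y \<le> frac x"
      then have "real_of_int \<lfloor>y\<rfloor> = \<lfloor>x\<rfloor> + 1" by simp
      with A * show ?thesis by linarith
    qed
  qed
qed

text \<open>By \<open>step_iff_floor_frac\<close> a weakly monotone change of the fractional parts
  keeps the step condition. The value 1 is allowed: it carries the point to the next integer, still
  at most \<open>q k\<close>, because a nonzero fractional part leaves
  \<open>\<lfloor>s k\<rfloor> < q k\<close>. Fixing 0 protects the points that already sit on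
  \<open>q k\<close>.\<close>

lemma height_profile_map_frac:
  assumes s: "height_profile n r p q s"
    and mono: "mono_on ((\<lambda>k. frac (s k)) ` {..n}) \<psi>"
    and zero: "\<psi> 0 = 0" and range: "\<And>k. k \<le> n \<Longrightarrow> 0 \<le> \<psi> (frac (s k)) \<and> \<psi> (frac (s k)) \<le> 1"
  shows "height_profile n r p q (\<lambda>k. of_int \<lfloor>s k\<rfloor> + \<psi> (frac (s k)))"
  unfolding height_profile_def
proof (intro conjI allI impI)
  have s0: "s 0 = 0" "s n = real r" using s by (auto simp: height_profile_def)
  then show "real_of_int \<lfloor>s 0\<rfloor> + \<psi> (frac (s 0)) = 0" "real_of_int \<lfloor>s n\<rfloor> + \<psi> (frac (s n)) = real r"
    using zero by (auto simp: frac_def)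
  fix k assume k: "k < n"
  have "0 \<le> s (Suc k) - s k \<and> s (Suc k) - s k \<le> 1" using s k by (auto simp: height_profile_def)
  then have "(\<lfloor>s (Suc k)\<rfloor> = \<lfloor>s k\<rfloor> \<and> frac (s k) \<le> frac (s (Suc k))) \<or>
     (\<lfloor>s (Suc k)\<rfloor> = \<lfloor>s k\<rfloor> + 1 \<and> frac (s (Suc k)) \<le> frac (s k))"
    by (simp only: step_iff_floor_frac)
  moreover have "frac (s k) \<in> (\<lambda>k. frac (s k)) ` {..n}" "frac (s (Suc k)) \<in> (\<lambda>k. frac (s k)) ` {..n}"
    using k by auto
  ultimately have "(\<lfloor>s (Suc k)\<rfloor> = \<lfloor>s k\<rfloor> \<and> \<psi> (frac (s k)) \<le> \<psi> (frac (s (Suc k)))) \<or>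
     (\<lfloor>s (Suc k)\<rfloor> = \<lfloor>s k\<rfloor> + 1 \<and> \<psi> (frac (s (Suc k))) \<le> \<psi> (frac (s k)))"
    using mono by (auto simp: mono_on_def)
  moreover have "0 \<le> \<psi> (frac (s k)) \<and> \<psi> (frac (s k)) \<le> 1"
    "0 \<le> \<psi> (frac (s (Suc k))) \<and> \<psi> (frac (s (Suc k))) \<le> 1"
    using range k by auto
  ultimately show
     "0 \<le> real_of_int \<lfloor>s (Suc k)\<rfloor> + \<psi> (frac (s (Suc k))) - (real_of_int \<lfloor>s k\<rfloor> + \<psi> (frac (s k)))"
     "real_of_int \<lfloor>s (Suc k)\<rfloor> + \<psi> (frac (s (Suc k))) - (real_of_int \<lfloor>s k\<rfloor> + \<psi> (frac (s k))) \<le> 1"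
    by auto
next
  fix k assume k: "k \<le> n"
  have b: "real (p k) \<le> s k" "s k \<le> real (q k)" using s k by (auto simp: height_profile_def)
  have "int (p k) \<le> \<lfloor>s k\<rfloor>" using b by linarith
  then show "real (p k) \<le> real_of_int \<lfloor>s k\<rfloor> + \<psi> (frac (s k))"
    using range[OF k] by linarith
  show "real_of_int \<lfloor>s k\<rfloor> + \<psi> (frac (s k)) \<le> real (q k)"
  proof (cases "frac (s k) = 0")
    case True
    then show ?thesis using zero b by (simp add: frac_def)
  next
    case False
    then have "\<lfloor>s k\<rfloor> < int (q k)" using b frac_ge_0[of "s k"] unfolding frac_def by linarith
    then show ?thesis using range[OF k] by linarith
  qed
qed

text \<open>Integrality of the polytope of profiles. Instead of classifying vertices, the number of
  distinct fractional parts is driven down to one, the value 0, where the profile is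
  integral.\<close>

lemma increments_in_convex_hull:
  assumes "height_profile n r p q s"
    and integral: "\<And>s. \<lbrakk>height_profile n r p q s; \<And>k. k \<le> n \<Longrightarrow> s k \<in> \<int>\<rbrakk> \<Longrightarrow> increments n s \<in> X"
  shows "increments n s \<in> convex hull X"
  using assms(1)
proof (induction "card ((\<lambda>k. frac (s k)) ` {..n})" arbitrary: s rule: less_induct)
  case less
  \<comment> \<open>Moving the largest fractional part \<open>f\<close> up to 1 or down to the next smaller one \<open>g\<close> writes \<open>s\<close>
    as a convex combination of two profiles with fewer distinct fractional parts.\<close>
  define F where "F = (\<lambda>k. frac (s k)) ` {..n}"
  have finF: "finite F" by (auto simp: F_def)
  have F01: "0 \<le> t \<and> t < 1" if "t \<in> F" for t using that by (auto simp: F_def frac_lt_1)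
  \<comment> \<open>From \<open>s 0 = 0\<close>. It makes \<open>g\<close> exist once
    \<open>F\<close> is not \<open>{0}\<close>, and lets a push to 1 land on a fractional part
    already in \<open>F\<close>.\<close>
  have "0 \<in> F" using less.prems by (force simp: F_def height_profile_def)
  show ?case
  proof (cases "F = {0}")
    case True
    then have "s k \<in> \<int>" if "k \<le> n" for k using that
      by (metis F_def atMost_iff frac_eq_0_iff image_eqI singletonD)
    then show ?thesis using integral[OF less.prems] by (auto intro: hull_inc)
  next
    case False
    define f where "f = Max F"
    define g where "g = Max (F - {f})"
    have fF: "f \<in> F" unfolding f_def by (rule Max_in) (use finF \<open>0 \<in> F\<close> in auto)
    have f_max: "t \<le> f" if "t \<in> F" for t using that finF by (auto simp: f_def)
    have f_pos: "0 < f"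
    proof (rule ccontr)
      assume "\<not> 0 < f"
      then have "F \<subseteq> {0}" using f_max F01 by force
      with \<open>0 \<in> F\<close> False show False by auto
    qed
    have gF: "g \<in> F - {f}" unfolding g_def
      by (rule Max_in) (use finF \<open>0 \<in> F\<close> f_pos in auto)
    have g_max: "t \<le> g" if "t \<in> F" "t \<noteq> f" for t using that finF by (auto simp: g_def)
    have "g < f" using gF f_max by force
    have f1: "f < 1" and g0: "0 \<le> g" using F01 fF gF by auto
    define push where "push c = (\<lambda>k. of_int \<lfloor>s k\<rfloor> + (if frac (s k) = f then c else frac (s k)))" for c
    have push: "increments n (push c) \<in> convex hull X" if c: "c = 1 \<or> c = g" for c
    proof (rule less.hyps)
      show "height_profile n r p q (push c)"
        unfolding push_def
      proof (rule height_profile_map_frac[OF less.prems, where \<psi> = "\<lambda>t. if t = f then c else t"])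
        \<comment> \<open>No element of \<open>F\<close> lies above \<open>f\<close> or strictly
          between \<open>g\<close> and \<open>f\<close>, so neither push overtakes another
          fractional part.\<close>
        show "mono_on ((\<lambda>k. frac (s k)) ` {..n}) (\<lambda>t. if t = f then c else t)"
          unfolding F_def[symmetric] using c f_max g_max F01 f1 \<open>g < f\<close>
          by (force simp: mono_on_def)
        show "(if 0 = f then c else 0) = 0" using f_pos by auto
        fix k assume "k \<le> n"
        then show "0 \<le> (if frac (s k) = f then c else frac (s k)) \<and> (if frac (s k) = f then c else frac (s k)) \<le> 1"
          using c g0 f1 \<open>g < f\<close> by (smt (verit) frac_ge_0 frac_lt_1)
      qed
      have "frac (push c k) \<in> F - {f}" if "k \<le> n" for k
      proof (cases "frac (s k) = f")
        case True
        show ?thesis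
          using c
        proof
          assume "c = 1"
          then have "push c k \<in> \<int>" using True by (simp add: push_def)
          then have "frac (push c k) = 0" by simp
          then show ?thesis using \<open>0 \<in> F\<close> f_pos by (metis DiffI less_irrefl singletonD)
        next
          assume "c = g"
          then have "frac (push c k) = g" using True g0 f1 \<open>g < f\<close>
            by (simp add: push_def frac_unique_iff)
          then show ?thesis using gF by auto
        qed
      next
        case False
        then show ?thesis using that by (auto simp: push_def F_def frac_def)
      qed
      then have "(\<lambda>k. frac (push c k)) ` {..n} \<subset> F" using fF by auto
      then show "card ((\<lambda>k. frac (push c k)) ` {..n}) < card ((\<lambda>k. frac (s k)) ` {..n})"
        using finF unfolding F_def[symmetric] by (rule psubset_card_mono[rotated])
    qed
    \<comment> \<open>The weight solving \<open>l * 1 + (1 - l) * g = f\<close>, so that the two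
      pushes average back to \<open>s\<close>.\<close>
    define l where "l = (f - g) / (1 - g)"
    have "l * (1 - g) = f - g" using \<open>g < f\<close> f1 by (simp add: l_def)
    moreover have "l + (1 - l) * g = l * (1 - g) + g" by algebra
    ultimately have l: "0 \<le> l" "l \<le> 1" "l + (1 - l) * g = f"
      using \<open>g < f\<close> f1 by (simp_all add: l_def)
    have "s = (\<lambda>k. l * push 1 k + (1 - l) * push g k)"
    proof
      fix k
      show "s k = l * push 1 k + (1 - l) * push g k"
      proof (cases "frac (s k) = f")
        case True
        then have "l * push 1 k + (1 - l) * push g k = of_int \<lfloor>s k\<rfloor> + (l + (1 - l) * g)"
          by (simp add: push_def algebra_simps)
        also have "\<dots> = s k" using l True by (simp add: frac_def)
        finally show ?thesis by simp
      qed (simp add: push_def frac_def algebra_simps)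
    qed
    then have "increments n s = l *\<^sub>R increments n (push 1) + (1 - l) *\<^sub>R increments n (push g)"
      using increments_convex_combination[of n l "push 1" "1 - l" "push g"] by simp
    also have "\<dots> \<in> convex hull X"
      by (rule convexD[OF convex_convex_hull]) (use push l in auto)
    finally show ?thesis .
  qed
qed


section \<open>Lattice paths, bases and the matroid polytope in terms of heights\<close>

lemma count_list_E_add_N: "count_list w E + count_list w N = length w"
proof (induction w)
  case (Cons a w) then show ?case by (cases a) auto
qed simp

lemma lattice_path_length: "lattice_path m r w \<Longrightarrow> length w = m + r"
  using count_list_E_add_N[of w] by (simp add: lattice_path_def)

lemma height_0: "height w 0 = 0"
  by (simp add: height_def)

lemma height_end: "lattice_path m r w \<Longrightarrow> height w (m + r) = r"
  using lattice_path_length[of m r w] by (simp add: height_def lattice_path_def)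

lemma height_Suc_bounds: "height w k \<le> height w (Suc k)" "height w (Suc k) \<le> Suc (height w k)"
proof -
  have "height w (Suc k) = height w k \<or> height w (Suc k) = Suc (height w k)"
    by (cases "k < length w") (auto simp: height_def take_Suc_conv_app_nth)
  then show "height w k \<le> height w (Suc k)" "height w (Suc k) \<le> Suc (height w k)" by auto
qed

lemma region_points_iff:
  "(x, y) \<in> region_points P Q \<longleftrightarrow>
     x + y \<le> length P \<and> height P (x + y) \<le> y \<and> y \<le> height Q (x + y)"
  by (simp add: region_points_def vertex_def height_def)

lemma height_path_of_set:
  assumes "k \<le> n" shows "height (path_of_set n B) k = card (B \<inter> {1..k})"
proof -
  have "take k (path_of_set n B) = map (\<lambda>i. if i \<in> B then N else E) [1..<k + 1]"
    using assms by (simp add: path_of_set_def take_map take_upt del: upt_Suc)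
  moreover have "count_list (map (\<lambda>i. if i \<in> B then N else E) [1..<k + 1]) N = card (B \<inter> {1..k})"
  proof (induction k)
    case (Suc k)
    have "B \<inter> {1..Suc k} = (if Suc k \<in> B then insert (Suc k) (B \<inter> {1..k}) else B \<inter> {1..k})"
      by (auto simp: le_Suc_eq)
    then show ?case using Suc by simp
  qed simp
  ultimately show ?thesis by (simp add: height_def)
qed

lemma vertex_path_of_set:
  assumes "k \<le> n"
  shows "vertex (path_of_set n B) k = (k - card (B \<inter> {1..k}), card (B \<inter> {1..k}))"
    and "card (B \<inter> {1..k}) \<le> k"
proof -
  have "length (take k (path_of_set n B)) = k" using assms by (simp add: path_of_set_def)
  then have "count_list (take k (path_of_set n B)) E + card (B \<inter> {1..k}) = k"
    using count_list_E_add_N[of "take k (path_of_set n B)"] height_path_of_set[OF assms, of B]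
    by (simp add: height_def)
  then show "vertex (path_of_set n B) k = (k - card (B \<inter> {1..k}), card (B \<inter> {1..k}))"
    "card (B \<inter> {1..k}) \<le> k"
    using height_path_of_set[OF assms, of B] by (auto simp: vertex_def height_def)
qed

text \<open>The vertex reached after \<open>k\<close> steps lies on antidiagonal \<open>k\<close>,
  so membership in the region is a comparison of heights alone.\<close>

lemma bases_lattice_path_matroid_iff:
  assumes "length P = m + r"
  shows "B \<in> bases (lattice_path_matroid m r P Q) \<longleftrightarrow> B \<subseteq> {1..m + r} \<and> card B = r \<and>
    (\<forall>k\<le>m + r. height P k \<le> card (B \<inter> {1..k}) \<and> card (B \<inter> {1..k}) \<le> height Q k)"
proof -
  have "vertex (path_of_set (m + r) B) k \<in> region_points P Q \<longleftrightarrow>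
      height P k \<le> card (B \<inter> {1..k}) \<and> card (B \<inter> {1..k}) \<le> height Q k" if "k \<le> m + r" for k
    using vertex_path_of_set[OF that, of B] assms that by (simp add: region_points_iff)
  then show ?thesis by (auto simp: lattice_path_matroid_def)
qed

text \<open>Partial sums turn the vector of \<open>B\<close> into the height function of the path of
  \<open>B\<close>; this places the basis vectors among the profiles.\<close>

lemma sum_lookup_basis_vector:
  fixes B :: "nat set"
  assumes "finite B"
  shows "(\<Sum>i=1..k. Poly_Mapping.lookup (\<Sum>j\<in>B. Poly_Mapping.single j (1::real)) i) = real (card (B \<inter> {1..k}))"
proof -
  have "(\<Sum>i=1..k. Poly_Mapping.lookup (\<Sum>j\<in>B. Poly_Mapping.single j (1::real)) i) =
    (\<Sum>i=1..k. if i \<in> B then 1 else 0)"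
    using assms by (intro sum.cong) (auto simp: lookup_sum lookup_single when_def sum.delta)
  also have "\<dots> = real (card (B \<inter> {1..k}))"
    by (simp add: sum.If_cases Int_commute)
  finally show ?thesis .
qed

lemma height_profile_convex:
  assumes "height_profile n r p q s" "height_profile n r p q t" "0 \<le> u" "0 \<le> v" "u + v = 1"
  shows "height_profile n r p q (\<lambda>k. u * s k + v * t k)"
  unfolding height_profile_def
proof (intro conjI allI impI)
  note st = assms(1,2)[unfolded height_profile_def]
  have bound: "l \<le> u * a + v * b \<and> u * a + v * b \<le> h"
    if "l \<le> a" "l \<le> b" "a \<le> h" "b \<le> h" for a b l h :: real
  proof
    have "u * l + v * l = l" using assms(5) by (simp flip: distrib_right)
    then show "l \<le> u * a + v * b"
      using that assms(3,4) by (metis add_mono mult_left_mono)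
    show "u * a + v * b \<le> h" using that assms by (intro convex_bound_le)
  qed
  show "u * s 0 + v * t 0 = 0" using st by simp
  show "u * s n + v * t n = real r" using st assms(5) by (simp flip: distrib_right)
  fix k assume k: "k < n"
  have "0 \<le> u * (s (Suc k) - s k) + v * (t (Suc k) - t k) \<and> u * (s (Suc k) - s k) + v * (t (Suc k) - t k) \<le> 1"
    by (rule bound) (use st k in auto)
  then show "0 \<le> u * s (Suc k) + v * t (Suc k) - (u * s k + v * t k)"
    "u * s (Suc k) + v * t (Suc k) - (u * s k + v * t k) \<le> 1"
    by (auto simp: algebra_simps)
next
  note st = assms(1,2)[unfolded height_profile_def]
  fix k assume k: "k \<le> n"
  have "u * real (p k) + v * real (p k) \<le> u * s k + v * t k"
    using st k assms(3,4) by (intro add_mono mult_left_mono) auto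
  then show "real (p k) \<le> u * s k + v * t k" using assms(5) by (simp flip: distrib_right)
  show "u * s k + v * t k \<le> real (q k)" using st k assms by (intro convex_bound_le) auto
qed

text \<open>An integer step in \<open>[0, 1]\<close> is 0 or 1. The positions of the 1s form the
  basis, whose counting function is \<open>s\<close> again.\<close>

lemma integral_increments_basis_vector:
  assumes P: "length P = m + r" and s: "height_profile (m + r) r (height P) (height Q) s"
    and integral: "\<And>k. k \<le> m + r \<Longrightarrow> s k \<in> \<int>"
  shows "increments (m + r) s \<in>
    (\<lambda>B. \<Sum>i\<in>B. Poly_Mapping.single i 1) ` bases (lattice_path_matroid m r P Q)"
proof -
  define B where "B = {i \<in> {1..m + r}. s i - s (i - 1) = 1}"
  have B: "finite B" "B \<subseteq> {1..m + r}" by (auto simp: B_def)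
  have inc: "s i - s (i - 1) = (if i \<in> B then 1 else 0)" if i: "i \<in> {1..m + r}" for i
  proof -
    obtain j where j: "i = Suc j" "j < m + r" using i by (cases i) auto
    then have "0 \<le> s i - s (i - 1) \<and> s i - s (i - 1) \<le> 1"
      using s unfolding height_profile_def by simp
    moreover have "s i - s (i - 1) \<in> \<int>" using i by (intro Ints_diff integral) auto
    ultimately have "s i - s (i - 1) = 0 \<or> s i - s (i - 1) = 1" by (auto elim!: Ints_cases)
    then show ?thesis using i by (auto simp: B_def)
  qed
  have card_B: "real (card (B \<inter> {1..k})) = s k" if "k \<le> m + r" for k
    using that
  proof (induction k)
    case 0 then show ?case using s by (simp add: height_profile_def)
  next
    case (Suc k)
    have "B \<inter> {1..Suc k} = (if Suc k \<in> B then insert (Suc k) (B \<inter> {1..k}) else B \<inter> {1..k})"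
      by (auto simp: le_Suc_eq)
    then show ?case using Suc inc[of "Suc k"] B by (auto split: if_splits)
  qed
  have "B \<in> bases (lattice_path_matroid m r P Q)"
    unfolding bases_lattice_path_matroid_iff[OF P]
  proof (intro conjI allI impI B)
    have "B \<inter> {1..m + r} = B" using B by auto
    then show "card B = r" using card_B[of "m + r"] s by (simp add: height_profile_def)
    fix k assume "k \<le> m + r"
    then have "real (height P k) \<le> card (B \<inter> {1..k})" "card (B \<inter> {1..k}) \<le> real (height Q k)"
      using s card_B by (auto simp: height_profile_def)
    then show "height P k \<le> card (B \<inter> {1..k})" "card (B \<inter> {1..k}) \<le> height Q k" by auto
  qed
  moreover have "increments (m + r) s = (\<Sum>i\<in>B. Poly_Mapping.single i 1)"
  proof (rule poly_mapping_eqI)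
    fix i
    show "Poly_Mapping.lookup (increments (m + r) s) i = Poly_Mapping.lookup (\<Sum>i\<in>B. Poly_Mapping.single i 1) i"
      using B inc[of i] by (auto simp: lookup_increments lookup_sum lookup_single when_def sum.delta)
  qed
  ultimately show ?thesis by blast
qed

text \<open>One inclusion holds because the profile conditions are convex and hold at the basis
  vectors, the other is integrality.\<close>

lemma matroid_polytope_image:
  assumes P: "lattice_path m r P"
  shows "(\<lambda>x. restrict (Poly_Mapping.lookup x) {1..<m + r}) ` matroid_polytope (lattice_path_matroid m r P Q) =
    {restrict (\<lambda>i. s i - s (i - 1)) {1..<m + r} | s. height_profile (m + r) r (height P) (height Q) s}"
    (is "?lhs = ?rhs")
proof (rule equalityI; rule subsetI)
  have len: "length P = m + r" by (rule lattice_path_length[OF P])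
  let ?H = "height_profile (m + r) r (height P) (height Q)"
  let ?S = "\<lambda>x k. \<Sum>i=1..k. Poly_Mapping.lookup x i :: real"
  let ?X = "(\<lambda>B. \<Sum>i\<in>B. Poly_Mapping.single i 1 :: nat \<Rightarrow>\<^sub>0 real) ` bases (lattice_path_matroid m r P Q)"
  have hull: "convex hull ?X \<subseteq> {x. ?H (?S x)}"
  proof (rule hull_minimal)
    show "convex {x. ?H (?S x)}"
    proof (rule convexI)
      fix x y :: "nat \<Rightarrow>\<^sub>0 real" and u v :: real
      assume "x \<in> {x. ?H (?S x)}" "y \<in> {x. ?H (?S x)}" and uv: "0 \<le> u" "0 \<le> v" "u + v = 1"
      then have "?H (\<lambda>k. u * ?S x k + v * ?S y k)" by (intro height_profile_convex) auto
      also have "(\<lambda>k. u * ?S x k + v * ?S y k) = ?S (u *\<^sub>R x + v *\<^sub>R y)"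
        by (simp add: lookup_add lookup_scaleR sum.distrib sum_distrib_left)
      finally show "u *\<^sub>R x + v *\<^sub>R y \<in> {x. ?H (?S x)}" by simp
    qed
    show "?X \<subseteq> {x. ?H (?S x)}"
    proof
      fix x assume "x \<in> ?X"
      then obtain B where B: "B \<in> bases (lattice_path_matroid m r P Q)"
        and x: "x = (\<Sum>i\<in>B. Poly_Mapping.single i 1)" by blast
      note B = B[unfolded bases_lattice_path_matroid_iff[OF len]]
      then have fin: "finite B" using finite_subset by blast
      have "?S x = (\<lambda>k. real (card (B \<inter> {1..k})))"
        unfolding x using sum_lookup_basis_vector[OF fin] by blast
      moreover have "?H (\<lambda>k. real (card (B \<inter> {1..k})))"
        unfolding height_profile_def
      proof (intro conjI allI impI)
        have "B \<inter> {1..m + r} = B" using B by auto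
        then show "real (card (B \<inter> {1..m + r})) = real r" using B by simp
        fix k
        have "B \<inter> {1..Suc k} = (if Suc k \<in> B then insert (Suc k) (B \<inter> {1..k}) else B \<inter> {1..k})"
          by (auto simp: le_Suc_eq)
        then show "0 \<le> real (card (B \<inter> {1..Suc k})) - real (card (B \<inter> {1..k}))"
          "real (card (B \<inter> {1..Suc k})) - real (card (B \<inter> {1..k})) \<le> 1"
          using fin by auto
      qed (use B in auto)
      ultimately show "x \<in> {x. ?H (?S x)}" by simp
    qed
  qed
  fix z
  {
    assume "z \<in> ?lhs"
    then obtain x where "x \<in> convex hull ?X" and z: "z = restrict (Poly_Mapping.lookup x) {1..<m + r}"
      unfolding matroid_polytope_def by blast
    with hull have "?H (?S x)" by blast
    moreover have "?S x i - ?S x (i - 1) = Poly_Mapping.lookup x i" if "1 \<le> i" for i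
      using that by (cases i) auto
    then have "z = restrict (\<lambda>i. ?S x i - ?S x (i - 1)) {1..<m + r}"
      unfolding z by (intro restrict_ext) auto
    ultimately show "z \<in> ?rhs" by (intro CollectI exI[of _ "?S x"] conjI)
  next
    assume "z \<in> ?rhs"
    then obtain s where z: "z = restrict (\<lambda>i. s i - s (i - 1)) {1..<m + r}" and s: "?H s" by blast
    have "increments (m + r) s \<in> convex hull ?X"
      by (rule increments_in_convex_hull[OF s]) (rule integral_increments_basis_vector[OF len])
    moreover have "z = restrict (Poly_Mapping.lookup (increments (m + r) s)) {1..<m + r}"
      unfolding z by (intro restrict_ext) (auto simp: lookup_increments)
    ultimately show "z \<in> ?lhs" unfolding matroid_polytope_def by blast
  }
qed


subsection \<open>Measure-preserving maps and null sets\<close>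

abbreviation lborel_on :: "nat set \<Rightarrow> (nat \<Rightarrow> real) measure" where
  "lborel_on I \<equiv> Pi\<^sub>M I (\<lambda>_. lborel)"

interpretation lborel_product: product_sigma_finite "\<lambda>_::nat. lborel :: real measure"
  by standard

text \<open>The product measure is determined by its values on boxes, and a translation moves boxes
  to boxes; the claim reduces to translation invariance in each coordinate.\<close>

lemma lborel_on_translate:
  assumes [simp]: "finite I"
  shows "distr (lborel_on I) (lborel_on I) (\<lambda>x. \<lambda>k\<in>I. x k - a k) = lborel_on I"
proof (rule lborel_product.PiM_eqI)
  have meas: "(\<lambda>x. \<lambda>k\<in>I. x k - a k) \<in> lborel_on I \<rightarrow>\<^sub>M lborel_on I" by measurable
  fix A :: "nat \<Rightarrow> real set" assume A: "\<And>i. i \<in> I \<Longrightarrow> A i \<in> sets lborel"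
  have "emeasure (distr (lborel_on I) (lborel_on I) (\<lambda>x. \<lambda>k\<in>I. x k - a k)) (Pi\<^sub>E I A)
    = emeasure (lborel_on I) ((\<lambda>x. \<lambda>k\<in>I. x k - a k) -` (Pi\<^sub>E I A) \<inter> space (lborel_on I))"
    by (rule emeasure_distr[OF meas]) (auto intro!: sets_PiM_I_finite A)
  also have "(\<lambda>x. \<lambda>k\<in>I. x k - a k) -` (Pi\<^sub>E I A) \<inter> space (lborel_on I) =
      Pi\<^sub>E I (\<lambda>k. (\<lambda>y. y - a k) -` A k)"
    by (auto simp: space_PiM PiE_def Pi_def)
  also have "emeasure (lborel_on I) \<dots> = (\<Prod>k\<in>I. emeasure lborel ((\<lambda>y. y - a k) -` A k))"
  proof (rule lborel_product.emeasure_PiM)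
    show "(\<lambda>y. y - a i) -` A i \<in> sets lborel" if "i \<in> I" for i
    proof -
      have "(\<lambda>y::real. y - a i) \<in> borel_measurable borel" by simp
      from measurable_sets[OF this, of "A i"] A[OF that] show ?thesis by simp
    qed
  qed simp
  also have "\<dots> = (\<Prod>k\<in>I. emeasure lborel (A k))"
  proof (rule prod.cong[OF refl])
    fix k assume k: "k \<in> I"
    have "emeasure lborel (A k) = emeasure (distr lborel borel ((+) (- a k))) (A k)"
      by (simp add: lborel_distr_plus)
    also have "(+) (- a k) = (\<lambda>y. y - a k)" by auto
    also have "emeasure (distr lborel borel (\<lambda>y. y - a k)) (A k) = emeasure lborel ((\<lambda>y. y - a k) -` A k)"
      using A[OF k] by (subst emeasure_distr) auto
    finally show "emeasure lborel ((\<lambda>y. y - a k) -` A k) = emeasure lborel (A k)" by simp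
  qed
  finally show "emeasure (distr (lborel_on I) (lborel_on I) (\<lambda>x. \<lambda>k\<in>I. x k - a k)) (Pi\<^sub>E I A) =
    (\<Prod>i\<in>I. emeasure lborel (A i))" .
qed simp_all

text \<open>The preimage of a box is the box with its sides rearranged by \<open>inv \<tau>\<close>,
  and reindexing leaves the product of the lengths unchanged.\<close>

lemma lborel_on_permute:
  assumes [simp]: "finite I" and \<tau>: "\<tau> permutes I"
  shows "distr (lborel_on I) (lborel_on I) (\<lambda>x. \<lambda>k\<in>I. x (\<tau> k)) = lborel_on I"
proof (rule lborel_product.PiM_eqI)
  have tI: "\<tau> k \<in> I" if "k \<in> I" for k using permutes_in_image[OF \<tau>] that by simp
  have meas: "(\<lambda>x. \<lambda>k\<in>I. x (\<tau> k)) \<in> lborel_on I \<rightarrow>\<^sub>M lborel_on I"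
    by (rule measurable_restrict) (use tI in measurable)
  fix A :: "nat \<Rightarrow> real set" assume A: "\<And>i. i \<in> I \<Longrightarrow> A i \<in> sets lborel"
  have "emeasure (distr (lborel_on I) (lborel_on I) (\<lambda>x. \<lambda>k\<in>I. x (\<tau> k))) (Pi\<^sub>E I A)
    = emeasure (lborel_on I) ((\<lambda>x. \<lambda>k\<in>I. x (\<tau> k)) -` (Pi\<^sub>E I A) \<inter> space (lborel_on I))"
    by (rule emeasure_distr[OF meas]) (auto intro!: sets_PiM_I_finite A)
  also have "(\<lambda>x. \<lambda>k\<in>I. x (\<tau> k)) -` (Pi\<^sub>E I A) \<inter> space (lborel_on I) =
      Pi\<^sub>E I (\<lambda>k. A (inv \<tau> k))"
  proof -
    have "(\<forall>k\<in>I. x (\<tau> k) \<in> A k) \<longleftrightarrow> (\<forall>k\<in>I. x k \<in> A (inv \<tau> k))" for x :: "nat \<Rightarrow> real"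
      using permutes_in_image[OF \<tau>] permutes_in_image[OF permutes_inv[OF \<tau>]] permutes_inverses[OF \<tau>] by metis
    then show ?thesis by (auto simp: space_PiM PiE_def Pi_def)
  qed
  also have "emeasure (lborel_on I) \<dots> = (\<Prod>k\<in>I. emeasure lborel (A (inv \<tau> k)))"
    by (rule lborel_product.emeasure_PiM) (use A permutes_in_image[OF permutes_inv[OF \<tau>]] in auto)
  also have "\<dots> = (\<Prod>k\<in>I. emeasure lborel (A k))"
    using prod.permute[OF permutes_inv[OF \<tau>], of "\<lambda>k. emeasure lborel (A k)"] by (simp add: o_def)
  finally show "emeasure (distr (lborel_on I) (lborel_on I) (\<lambda>x. \<lambda>k\<in>I. x (\<tau> k))) (Pi\<^sub>E I A) =
    (\<Prod>i\<in>I. emeasure lborel (A i))" .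
qed simp_all

lemma nn_integral_lborel_translate:
  fixes c :: real
  assumes "f \<in> borel_measurable borel"
  shows "(\<integral>\<^sup>+y. f (y + c) \<partial>lborel) = (\<integral>\<^sup>+y. f y \<partial>lborel)"
  using nn_integral_real_affine[of f 1 c] assms by (simp add: add.commute)

lemma measurable_partial_sums:
  "(\<lambda>x. \<lambda>k\<in>{1..<n}. \<Sum>i=1..k. x i) \<in> lborel_on {1..<n} \<rightarrow>\<^sub>M lborel_on {1..<n}"
proof (rule measurable_restrict)
  fix k assume k: "k \<in> {1..<n}"
  have "(\<lambda>x. \<Sum>i=1..k. x i) \<in> borel_measurable (lborel_on {1..<n})"
  proof (rule borel_measurable_sum)
    fix i assume "i \<in> {1..k}"
    then have "i \<in> {1..<n}" using k by auto
    from measurable_component_singleton[OF this, of "\<lambda>_. lborel"]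
    show "(\<lambda>x. x i) \<in> borel_measurable (lborel_on {1..<n})" by simp
  qed
  then show "(\<lambda>x. \<Sum>i=1..k. x i) \<in> lborel_on {1..<n} \<rightarrow>\<^sub>M lborel" by simp
qed

text \<open>The map is triangular: only the last partial sum involves the last coordinate, and with
  the others fixed it is that coordinate shifted by their sum. Integrals of arbitrary
  \<open>f\<close> replace volumes because the induction hypothesis is applied to \<open>f\<close>
  with the last coordinate integrated out.\<close>

lemma nn_integral_partial_sums:
  assumes "1 \<le> n" "f \<in> borel_measurable (lborel_on {1..<n})"
  shows "(\<integral>\<^sup>+x. f (\<lambda>k\<in>{1..<n}. \<Sum>i=1..k. x i) \<partial>lborel_on {1..<n}) = (\<integral>\<^sup>+x. f x \<partial>lborel_on {1..<n})"
  using assms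
proof (induction n arbitrary: f rule: nat_induct_at_least)
  case base
  then show ?case by (simp add: PiM_empty nn_integral_count_space_finite restrict_def)
next
  case (Suc n)
  let ?J = "{1..<n}"
  have ins: "{1..<Suc n} = insert n ?J" using Suc.hyps by auto
  have f: "f \<in> borel_measurable (lborel_on (insert n ?J))" using Suc.prems by (simp only: ins)
  have upd: "(\<lambda>(x, y). x(n := y)) \<in> (lborel_on ?J \<Otimes>\<^sub>M lborel) \<rightarrow>\<^sub>M lborel_on (insert n ?J)"
    by (rule measurable_add_dim)
  have T: "(\<lambda>x. \<lambda>k\<in>insert n ?J. \<Sum>i=1..k. x i) \<in> lborel_on (insert n ?J) \<rightarrow>\<^sub>M lborel_on (insert n ?J)"
    using measurable_partial_sums[of "Suc n"] by (simp only: ins)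
  have "(\<integral>\<^sup>+x. f (\<lambda>k\<in>insert n ?J. \<Sum>i=1..k. x i) \<partial>lborel_on (insert n ?J)) =
    (\<integral>\<^sup>+x. (\<integral>\<^sup>+y. f (\<lambda>k\<in>insert n ?J. \<Sum>i=1..k. (x(n := y)) i) \<partial>lborel) \<partial>lborel_on ?J)"
    by (rule lborel_product.product_nn_integral_insert) (use measurable_compose[OF T f] in auto)
  also have "\<dots> = (\<integral>\<^sup>+x. (\<integral>\<^sup>+y. f ((\<lambda>k\<in>?J. \<Sum>i=1..k. x i)(n := y)) \<partial>lborel) \<partial>lborel_on ?J)"
  proof (rule nn_integral_cong)
    fix x assume x: "x \<in> space (lborel_on ?J)"
    define z where "z = (\<lambda>k\<in>?J. \<Sum>i=1..k. x i)"
    define c where "c = (\<Sum>i\<in>?J. x i)"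
    have z: "z \<in> space (lborel_on ?J)" by (auto simp: z_def space_PiM)
    have *: "(\<lambda>k\<in>insert n ?J. \<Sum>i=1..k. (x(n := y)) i) = z(n := y + c)" for y
    proof
      fix k
      have "(\<Sum>i=1..n. (x(n := y)) i) = y + c"
      proof -
        have "{1..n} = insert n ?J" using Suc.hyps by auto
        then show ?thesis by (simp add: c_def)
      qed
      moreover have "(\<Sum>i=1..k. (x(n := y)) i) = (\<Sum>i=1..k. x i)" if "k \<in> ?J"
        by (rule sum.cong) (use that in auto)
      ultimately show "(\<lambda>k\<in>insert n ?J. \<Sum>i=1..k. (x(n := y)) i) k = (z(n := y + c)) k"
        by (auto simp: z_def)
    qed
    have "(\<lambda>y. f (z(n := y))) \<in> borel_measurable lborel"
      using measurable_compose[OF measurable_compose[OF measurable_Pair1'[OF z] upd] f] by simp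
    then have "(\<integral>\<^sup>+y. f (z(n := y + c)) \<partial>lborel) = (\<integral>\<^sup>+y. f (z(n := y)) \<partial>lborel)"
      by (intro nn_integral_lborel_translate) simp
    then show "(\<integral>\<^sup>+y. f (\<lambda>k\<in>insert n ?J. \<Sum>i=1..k. (x(n := y)) i) \<partial>lborel) =
      (\<integral>\<^sup>+y. f ((\<lambda>k\<in>?J. \<Sum>i=1..k. x i)(n := y)) \<partial>lborel)"
      by (simp only: * z_def[symmetric])
  qed
  also have "\<dots> = (\<integral>\<^sup>+x. (\<integral>\<^sup>+y. f (x(n := y)) \<partial>lborel) \<partial>lborel_on ?J)"
  proof (rule Suc.IH)
    have "(\<lambda>p. f ((\<lambda>(x, y). x(n := y)) p)) \<in> borel_measurable (lborel_on ?J \<Otimes>\<^sub>M lborel)"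
      by (rule measurable_compose[OF upd f])
    then show "(\<lambda>x. \<integral>\<^sup>+y. f (x(n := y)) \<partial>lborel) \<in> borel_measurable (lborel_on ?J)"
      by (intro lborel.borel_measurable_nn_integral) (simp add: case_prod_unfold)
  qed
  also have "\<dots> = (\<integral>\<^sup>+x. f x \<partial>lborel_on (insert n ?J))"
    by (rule lborel_product.product_nn_integral_insert[symmetric]) (use f in auto)
  finally show ?case by (simp only: ins)
qed

lemma emeasure_partial_sums_vimage:
  assumes "1 \<le> n" "A \<in> sets (lborel_on {1..<n})"
  shows "emeasure (lborel_on {1..<n})
      ((\<lambda>x. \<lambda>k\<in>{1..<n}. \<Sum>i=1..k. x i) -` A \<inter> space (lborel_on {1..<n})) =
    emeasure (lborel_on {1..<n}) A" (is "emeasure ?M (?T -` A \<inter> _) = _")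
proof -
  have "?T -` A \<inter> space ?M \<in> sets ?M" by (rule measurable_sets[OF measurable_partial_sums assms(2)])
  then have "emeasure ?M (?T -` A \<inter> space ?M) = (\<integral>\<^sup>+x. indicator (?T -` A \<inter> space ?M) x \<partial>?M)" by simp
  also have "\<dots> = (\<integral>\<^sup>+x. indicator A (?T x) \<partial>?M)"
    by (rule nn_integral_cong) (auto simp: indicator_def)
  also have "\<dots> = (\<integral>\<^sup>+x. indicator A x \<partial>?M)"
    by (rule nn_integral_partial_sums) (use assms in auto)
  finally show ?thesis using assms by simp
qed

text \<open>Integrating over coordinate \<open>k\<close> first meets each line in the single point
  \<open>g x\<close>, as \<open>indep\<close> makes \<open>g\<close> constant along that
  line.\<close>

lemma emeasure_graph_zero:
  assumes "finite I" "k \<in> I" and g[measurable]: "g \<in> borel_measurable (lborel_on I)"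
    and indep: "\<And>x y. g (x(k := y)) = g x"
  shows "emeasure (lborel_on I) {x \<in> space (lborel_on I). x k = g x} = 0"
proof -
  let ?J = "I - {k}" and ?G = "{x \<in> space (lborel_on I). x k = g x}"
  have I: "I = insert k ?J" using assms by auto
  have [measurable]: "(\<lambda>x. x k) \<in> borel_measurable (lborel_on I)"
    using measurable_component_singleton[OF assms(2), of "\<lambda>_. lborel"] by simp
  have G: "?G \<in> sets (lborel_on I)" by measurable
  have "emeasure (lborel_on I) ?G = (\<integral>\<^sup>+x. indicator ?G x \<partial>lborel_on (insert k ?J))"
    using nn_integral_indicator[OF G] I by metis
  also have "\<dots> = (\<integral>\<^sup>+x. (\<integral>\<^sup>+y. indicator ?G (x(k := y)) \<partial>lborel) \<partial>lborel_on ?J)"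
    by (rule lborel_product.product_nn_integral_insert) (use G I assms in auto)
  also have "\<dots> = (\<integral>\<^sup>+x. (\<integral>\<^sup>+y. indicator {g x} y \<partial>lborel) \<partial>lborel_on ?J)"
    by (intro nn_integral_cong) (use assms(2) in \<open>auto simp: indicator_def indep space_PiM PiE_def extensional_def\<close>)
  also have "\<dots> = 0" by simp
  finally show ?thesis .
qed

text \<open>Equal fractional parts are written as an integer difference, so that the set is a
  countable union of graphs \<open>x k = c\<close> and \<open>x k = x l + c\<close> with integers
  \<open>c\<close>.\<close>

definition fractional_ties :: "nat set \<Rightarrow> (nat \<Rightarrow> real) set" where
  "fractional_ties I = {x \<in> space (lborel_on I).
     (\<exists>k\<in>I. x k \<in> \<int>) \<or> (\<exists>k\<in>I. \<exists>l\<in>I. k \<noteq> l \<and> x k - x l \<in> \<int>)}"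

lemma fractional_ties_null:
  assumes "finite I"
  shows "fractional_ties I \<in> null_sets (lborel_on I)"
proof -
  have comp: "(\<lambda>x. x k) \<in> borel_measurable (lborel_on I)" if "k \<in> I" for k
    using measurable_component_singleton[OF that, of "\<lambda>_. lborel"] by simp
  have null: "{x \<in> space (lborel_on I). x k = g x} \<in> null_sets (lborel_on I)"
    if "k \<in> I" "g \<in> borel_measurable (lborel_on I)" "\<And>x y. g (x(k := y)) = g x" for k g
  proof (rule null_setsI)
    show "emeasure (lborel_on I) {x \<in> space (lborel_on I). x k = g x} = 0"
      by (rule emeasure_graph_zero) (use that assms in auto)
    show "{x \<in> space (lborel_on I). x k = g x} \<in> sets (lborel_on I)"
      using that comp[OF that(1)] by measurable
  qed
  have "(\<Union>k\<in>I. \<Union>c\<in>\<int>. {x \<in> space (lborel_on I). x k = c}) \<union>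
      (\<Union>k\<in>I. \<Union>l\<in>I - {k}. \<Union>c\<in>\<int>. {x \<in> space (lborel_on I). x k = x l + c}) \<in> null_sets (lborel_on I)"
    (is "?U \<in> _")
    by (intro null_sets.Un null_sets_UN' null)
       (use assms comp countable_int in \<open>auto simp: countable_finite\<close>)
  also have "?U = fractional_ties I"
  proof (intro set_eqI iffI)
    fix x assume "x \<in> ?U" then show "x \<in> fractional_ties I" by (fastforce simp: fractional_ties_def)
  next
    fix x assume "x \<in> fractional_ties I"
    then have x: "x \<in> space (lborel_on I)" and
      "(\<exists>k\<in>I. x k \<in> \<int>) \<or> (\<exists>k\<in>I. \<exists>l\<in>I. k \<noteq> l \<and> x k - x l \<in> \<int>)" by (auto simp: fractional_ties_def)
    from this(2) show "x \<in> ?U"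
    proof (elim disjE bexE conjE)
      fix k l assume "k \<in> I" "l \<in> I" "k \<noteq> l" "x k - x l \<in> \<int>"
      moreover have "x k = x l + (x k - x l)" by simp
      ultimately show ?thesis using x by blast
    qed (use x in blast)
  qed
  finally show ?thesis .
qed


subsection \<open>Order simplices\<close>

text \<open>Counting with \<open>\<le>\<close> makes the ranks start at 1; the identity outside
  \<open>I\<close> is what \<open>permutes\<close> demands.\<close>

definition rank_in :: "nat set \<Rightarrow> (nat \<Rightarrow> real) \<Rightarrow> nat \<Rightarrow> nat" where
  "rank_in I t k = (if k \<in> I then card {l \<in> I. t l \<le> t k} else k)"

lemma rank_in_less_iff:
  assumes "finite I" "k \<in> I" "l \<in> I"
  shows "rank_in I t k < rank_in I t l \<longleftrightarrow> t k < t l"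
proof
  assume "t k < t l"
  then have "{j \<in> I. t j \<le> t k} \<subset> {j \<in> I. t j \<le> t l}"
    using assms by (intro psubsetI) (force, blast intro: less_imp_le dest: leD)
  then show "rank_in I t k < rank_in I t l" using assms by (simp add: rank_in_def psubset_card_mono)
next
  assume *: "rank_in I t k < rank_in I t l"
  show "t k < t l"
  proof (rule ccontr)
    assume "\<not> t k < t l"
    then have "{j \<in> I. t j \<le> t l} \<subseteq> {j \<in> I. t j \<le> t k}" by auto
    then have "rank_in I t l \<le> rank_in I t k" using assms by (simp add: rank_in_def card_mono)
    with * show False by simp
  qed
qed

lemma rank_in_permutes:
  assumes "inj_on t {1..<n}"
  shows "rank_in {1..<n} t permutes {1..<n}"
proof (rule bij_imp_permutes)
  let ?I = "{1..<n}"
  have inj: "inj_on (rank_in ?I t) ?I"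
  proof (rule inj_onI)
    fix k l assume kl: "k \<in> ?I" "l \<in> ?I" "rank_in ?I t k = rank_in ?I t l"
    then have "\<not> t k < t l" "\<not> t l < t k" using rank_in_less_iff[of ?I] by (metis finite_atLeastLessThan less_irrefl)+
    then show "k = l" using assms kl by (metis inj_onD linorder_neqE)
  qed
  have "rank_in ?I t ` ?I \<subseteq> ?I"
  proof
    fix j assume "j \<in> rank_in ?I t ` ?I"
    then obtain k where k: "k \<in> ?I" "j = card {l \<in> ?I. t l \<le> t k}" by (auto simp: rank_in_def)
    have "0 < card {l \<in> ?I. t l \<le> t k}" using k(1) by (auto simp: card_gt_0_iff)
    moreover have "card {l \<in> ?I. t l \<le> t k} \<le> card ?I" by (rule card_mono) auto
    ultimately show "j \<in> ?I" using k by auto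
  qed
  then have "rank_in ?I t ` ?I = ?I" using card_image[OF inj] by (intro card_subset_eq) auto
  then show "bij_betw (rank_in ?I t) ?I ?I" using inj by (simp add: bij_betw_def)
qed (auto simp: rank_in_def)

text \<open>\<open>\<tau> k\<close> is itself the number of \<open>l\<close> with
  \<open>\<tau> l \<le> \<tau> k\<close>. One direction in \<open>ord\<close> is enough, as
  \<open>\<tau>\<close> is injective. Since a point thus determines its permutation, simplices and
  later alcoves of different permutations are disjoint.\<close>

lemma permutes_eq_rank_in:
  assumes \<tau>: "\<tau> permutes {1..<n}"
    and ord: "\<And>k l. k \<in> {1..<n} \<Longrightarrow> l \<in> {1..<n} \<Longrightarrow> \<tau> k < \<tau> l \<Longrightarrow> t k < t l"
  shows "\<tau> = rank_in {1..<n} t"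
proof
  fix k
  show "\<tau> k = rank_in {1..<n} t k"
  proof (cases "k \<in> {1..<n}")
    case True
    have "t l \<le> t k \<longleftrightarrow> \<tau> l \<le> \<tau> k" if l: "l \<in> {1..<n}" for l
    proof
      assume "t l \<le> t k"
      then show "\<tau> l \<le> \<tau> k" using ord[OF True l] by force
    next
      assume "\<tau> l \<le> \<tau> k"
      then have "\<tau> l < \<tau> k \<or> l = k" using permutes_inj[OF \<tau>] by (auto simp: inj_def le_less)
      then show "t l \<le> t k" using ord[OF l True] by auto
    qed
    then have "{l \<in> {1..<n}. t l \<le> t k} = {l \<in> {1..<n}. \<tau> l \<le> \<tau> k}" by auto
    also have "card \<dots> = card (\<tau> ` {l \<in> {1..<n}. \<tau> l \<le> \<tau> k})"
      using permutes_inj[OF \<tau>] by (intro card_image[symmetric]) (auto simp: inj_on_def inj_def)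
    moreover have "\<tau> ` {l \<in> {1..<n}. \<tau> l \<le> \<tau> k} = {1..\<tau> k}"
    proof -
      have "\<tau> k \<in> {1..<n}" using permutes_in_image[OF \<tau>] True by simp
      then have "j \<in> \<tau> ` {l \<in> {1..<n}. \<tau> l \<le> \<tau> k}" if "j \<in> {1..\<tau> k}" for j
        using that permutes_inverses(1)[OF \<tau>, of j] permutes_in_image[OF permutes_inv[OF \<tau>], of j]
        by (intro image_eqI[of _ _ "inv \<tau> j"]) auto
      moreover have "\<tau> l \<in> {1..<n}" if "l \<in> {1..<n}" for l using permutes_in_image[OF \<tau>] that by simp
      ultimately show ?thesis by fastforce
    qed
    ultimately show ?thesis using True by (simp add: rank_in_def)
  next
    case False
    then show ?thesis using permutes_not_in[OF \<tau> False] unfolding rank_in_def by (simp only: if_False)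
  qed
qed

definition order_simplex :: "nat set \<Rightarrow> (nat \<Rightarrow> nat) \<Rightarrow> (nat \<Rightarrow> real) set" where
  "order_simplex I \<tau> = {t \<in> space (lborel_on I).
     (\<forall>k\<in>I. 0 < t k \<and> t k < 1) \<and> (\<forall>k\<in>I. \<forall>l\<in>I. \<tau> k < \<tau> l \<longrightarrow> t k < t l)}"

lemma borel_measurable_component [measurable]:
  "k \<in> I \<Longrightarrow> (\<lambda>x. x k) \<in> borel_measurable (lborel_on I)"
  using measurable_component_singleton[of k I "\<lambda>_. lborel"] by simp

lemma order_simplex_sets [measurable]:
  assumes [simp]: "finite I" shows "order_simplex I \<tau> \<in> sets (lborel_on I)"
  unfolding order_simplex_def
proof (intro sets.sets_Collect_conj sets.sets_Collect_finite_All sets.sets_Collect_imp)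
qed (auto intro!: borel_measurable_less borel_measurable_component)

lemma order_simplex_eq_rank_in:
  assumes "t \<in> order_simplex {1..<n} \<tau>" "\<tau> permutes {1..<n}"
  shows "\<tau> = rank_in {1..<n} t"
  by (rule permutes_eq_rank_in) (use assms in \<open>auto simp: order_simplex_def\<close>)

text \<open>Composing a point with \<open>\<tau>\<close> preserves volume and pulls the simplex of
  \<open>\<tau>\<close> back to that of the identity.\<close>

lemma emeasure_order_simplex_permute:
  assumes \<tau>: "\<tau> permutes I" and [simp]: "finite I"
  shows "emeasure (lborel_on I) (order_simplex I \<tau>) = emeasure (lborel_on I) (order_simplex I id)"
proof -
  let ?R = "\<lambda>x. \<lambda>k\<in>I. x (\<tau> k)"
  have tI: "\<tau> k \<in> I" if "k \<in> I" for k using permutes_in_image[OF \<tau>] that by simp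
  have R: "?R \<in> lborel_on I \<rightarrow>\<^sub>M lborel_on I"
    by (rule measurable_restrict) (use tI in measurable)
  have surj: "\<exists>j\<in>I. k = \<tau> j" if "k \<in> I" for k
    using that permutes_image[OF \<tau>] by blast
  have "emeasure (lborel_on I) (order_simplex I \<tau>) =
      emeasure (distr (lborel_on I) (lborel_on I) ?R) (order_simplex I \<tau>)"
    by (simp add: lborel_on_permute[OF _ \<tau>])
  also have "\<dots> = emeasure (lborel_on I) (?R -` order_simplex I \<tau> \<inter> space (lborel_on I))"
    by (rule emeasure_distr[OF R]) simp
  also have "?R -` order_simplex I \<tau> \<inter> space (lborel_on I) = order_simplex I id"
  proof (intro set_eqI iffI)
    fix x assume x: "x \<in> ?R -` order_simplex I \<tau> \<inter> space (lborel_on I)"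
    show "x \<in> order_simplex I id"
      unfolding order_simplex_def
    proof (intro CollectI conjI ballI impI)
      show "x \<in> space (lborel_on I)" using x by simp
      fix k assume "k \<in> I"
      then obtain k' where k': "k' \<in> I" "k = \<tau> k'" using surj by blast
      then show "0 < x k" "x k < 1" using x by (auto simp: order_simplex_def)
      fix l assume "l \<in> I" "id k < id l"
      then obtain l' where "l' \<in> I" "l = \<tau> l'" using surj by blast
      then show "x k < x l" using x k' \<open>id k < id l\<close> by (auto simp: order_simplex_def)
    qed
  next
    fix x assume "x \<in> order_simplex I id"
    then show "x \<in> ?R -` order_simplex I \<tau> \<inter> space (lborel_on I)"
      using tI by (auto simp: order_simplex_def space_PiM)
  qed
  finally show ?thesis .
qed

text \<open>No integral is computed: up to ties, the open unit cube is the disjoint union of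
  \<open>(n - 1)!\<close> simplices of equal volume.\<close>

lemma emeasure_order_simplex:
  assumes \<tau>: "\<tau> permutes {1..<n}"
  shows "emeasure (lborel_on {1..<n}) (order_simplex {1..<n} \<tau>) = ennreal (1 / fact (n - 1))"
proof -
  let ?I = "{1..<n}" and ?S = "{\<tau>. \<tau> permutes {1..<n}}"
  let ?cube = "Pi\<^sub>E ?I (\<lambda>_. {0<..<1::real})"
  let ?c = "emeasure (lborel_on ?I) (order_simplex ?I id)"
  have fin: "finite ?S" by (simp add: finite_permutations)
  have cube: "?cube \<in> sets (lborel_on ?I)" by (auto intro!: sets_PiM_I_finite)
  have union: "(\<Union>\<tau>\<in>?S. order_simplex ?I \<tau>) \<in> sets (lborel_on ?I)"
    using fin by (intro sets.finite_UN) auto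
  have "1 = emeasure (lborel_on ?I) ?cube"
    by (subst lborel_product.emeasure_PiM) auto
  also have "\<dots> = emeasure (lborel_on ?I) ((\<Union>\<tau>\<in>?S. order_simplex ?I \<tau>) \<union> (?cube \<inter> fractional_ties ?I))"
  proof (rule arg_cong[where f = "emeasure _"], intro set_eqI iffI)
    fix t assume t: "t \<in> ?cube"
    show "t \<in> (\<Union>\<tau>\<in>?S. order_simplex ?I \<tau>) \<union> (?cube \<inter> fractional_ties ?I)"
    proof (cases "t \<in> fractional_ties ?I")
      case False
      then have "inj_on t ?I" using t
        by (force simp: inj_on_def fractional_ties_def space_PiM)
      then have "rank_in ?I t permutes ?I" by (rule rank_in_permutes)
      moreover have "t \<in> order_simplex ?I (rank_in ?I t)"
        using t by (auto simp: order_simplex_def rank_in_less_iff space_PiM PiE_def Pi_def)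
      ultimately show ?thesis by blast
    qed (use t in auto)
  qed (auto simp: order_simplex_def space_PiM)
  also have "\<dots> = emeasure (lborel_on ?I) (\<Union>\<tau>\<in>?S. order_simplex ?I \<tau>)"
    using union cube fractional_ties_null[of ?I] by (intro emeasure_Un_null_set null_set_Int1) auto
  also have "\<dots> = (\<Sum>\<tau>\<in>?S. emeasure (lborel_on ?I) (order_simplex ?I \<tau>))"
  proof (rule sum_emeasure[symmetric, OF _ _ fin])
    show "disjoint_family_on (order_simplex ?I) ?S"
      unfolding disjoint_family_on_def using order_simplex_eq_rank_in
      by (metis (no_types, lifting) disjoint_iff mem_Collect_eq)
  qed auto
  also have "\<dots> = (\<Sum>\<tau>\<in>?S. ?c)"
    by (rule sum.cong) (auto intro: emeasure_order_simplex_permute)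
  also have "\<dots> = of_nat (fact (n - 1)) * ?c"
    by (simp add: card_permutations[OF refl])
  finally have *: "of_nat (fact (n - 1)) * ?c = 1" by simp
  \<comment> \<open>\<open>?c\<close> is isolated by multiplying with the inverse factorial, because
    the values are extended reals.\<close>
  have "ennreal (1 / fact (n - 1)) = of_nat (fact (n - 1)) * ?c * ennreal (1 / fact (n - 1))"
    unfolding * by simp
  also have "\<dots> = ?c * (ennreal (real (fact (n - 1))) * ennreal (1 / fact (n - 1)))"
    by (simp add: ennreal_of_nat_eq_real_of_nat mult_ac)
  also have "ennreal (real (fact (n - 1))) * ennreal (1 / fact (n - 1)) = 1"
    by (subst ennreal_mult[symmetric]) (auto simp: field_simps)
  finally have "?c = ennreal (1 / fact (n - 1))" by (simp only: mult_1_right)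
  then show ?thesis by (simp only: emeasure_order_simplex_permute[OF \<tau> finite_atLeastLessThan])
qed


subsection \<open>Alcoves\<close>

definition descents :: "(nat \<Rightarrow> nat) \<Rightarrow> nat \<Rightarrow> nat" where
  "descents \<tau> k = card {i \<in> {1..<k}. \<tau> (Suc i) < \<tau> i}"

lemma descents_1: "descents \<tau> (Suc 0) = 0"
  by (simp add: descents_def)

lemma descents_Suc:
  assumes "1 \<le> k"
  shows "descents \<tau> (Suc k) = (if \<tau> (Suc k) < \<tau> k then Suc (descents \<tau> k) else descents \<tau> k)"
proof -
  have "{i \<in> {1..<Suc k}. \<tau> (Suc i) < \<tau> i} =
    (if \<tau> (Suc k) < \<tau> k then insert k {i \<in> {1..<k}. \<tau> (Suc i) < \<tau> i} else {i \<in> {1..<k}. \<tau> (Suc i) < \<tau> i})"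
    using assms by (auto simp: less_Suc_eq)
  then show ?thesis by (simp add: descents_def)
qed

text \<open>On the alcove of \<open>\<tau>\<close>, \<open>s k\<close> lies strictly between
  \<open>d = descents \<tau> k\<close> and \<open>d + 1\<close>, and both ends have to respect the
  integer bounds. The last step leads from such an interval at \<open>n - 1\<close> to the integer
  \<open>r\<close> with length in \<open>[0, 1]\<close>, which leaves only
  \<open>r = d + 1\<close>.\<close>

definition admissible_perms :: "nat \<Rightarrow> nat \<Rightarrow> (nat \<Rightarrow> nat) \<Rightarrow> (nat \<Rightarrow> nat) \<Rightarrow> (nat \<Rightarrow> nat) set" where
  "admissible_perms n r p q = {\<tau>. \<tau> permutes {1..<n} \<and> Suc (descents \<tau> (n - 1)) = r \<and>
     (\<forall>k\<in>{1..<n}. p k \<le> descents \<tau> k \<and> Suc (descents \<tau> k) \<le> q k)}"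

definition pin_ends :: "nat \<Rightarrow> nat \<Rightarrow> (nat \<Rightarrow> real) \<Rightarrow> nat \<Rightarrow> real" where
  "pin_ends n r x k = (if k = 0 then 0 else if k < n then x k else real r)"

definition profile_points :: "nat \<Rightarrow> nat \<Rightarrow> (nat \<Rightarrow> nat) \<Rightarrow> (nat \<Rightarrow> nat) \<Rightarrow> (nat \<Rightarrow> real) set" where
  "profile_points n r p q =
     {x \<in> space (lborel_on {1..<n}). height_profile n r p q (pin_ends n r x)}"

lemma profile_points_sets: "profile_points n r p q \<in> sets (lborel_on {1..<n})"
proof -
  have [measurable]: "(\<lambda>x. pin_ends n r x k) \<in> borel_measurable (lborel_on {1..<n})" for k
    by (cases "k = 0"; cases "k < n") (auto simp: pin_ends_def intro: borel_measurable_component)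
  show ?thesis unfolding profile_points_def height_profile_def by measurable
qed

lemma height_profile_cong:
  assumes "\<And>k. k \<le> n \<Longrightarrow> s k = t k"
  shows "height_profile n r p q s = height_profile n r p q t"
  using assms by (auto simp: height_profile_def Suc_le_eq)

text \<open>Partial sums of increments telescope back to the profile. The preimage form is the one
  for which \<open>emeasure_partial_sums_vimage\<close> gives the volume.\<close>

lemma increments_eq_vimage_partial_sums:
  assumes "1 \<le> n"
  shows "{restrict (\<lambda>i. s i - s (i - 1)) {1..<n} | s. height_profile n r p q s} =
    (\<lambda>x. \<lambda>k\<in>{1..<n}. \<Sum>i=1..k. x i) -` profile_points n r p q \<inter> space (lborel_on {1..<n})"
    (is "?lhs = ?T -` _ \<inter> _")
proof (intro set_eqI iffI)
  fix x assume "x \<in> ?lhs"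
  then obtain s where x: "x = restrict (\<lambda>i. s i - s (i - 1)) {1..<n}" and s: "height_profile n r p q s"
    by blast
  have "(\<Sum>i=1..k. s i - s (i - 1)) = s k - s 0" for k
    by (induction k) auto
  moreover have "(\<Sum>i=1..k. x i) = (\<Sum>i=1..k. s i - s (i - 1))" if "k < n" for k
    using that by (intro sum.cong) (auto simp: x)
  ultimately have T: "?T x = restrict s {1..<n}" using s
    by (intro restrict_ext) (auto simp: height_profile_def)
  have "height_profile n r p q (pin_ends n r (?T x))"
    unfolding T using s by (subst height_profile_cong[of _ _ s]) (auto simp: pin_ends_def height_profile_def)
  then show "x \<in> ?T -` profile_points n r p q \<inter> space (lborel_on {1..<n})"
    by (auto simp: profile_points_def T) (auto simp: space_PiM x)
next
  fix x assume x: "x \<in> ?T -` profile_points n r p q \<inter> space (lborel_on {1..<n})"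
  let ?s = "pin_ends n r (?T x)"
  have "x i = ?s i - ?s (i - 1)" if "i \<in> {1..<n}" for i
    using that by (cases i) (auto simp: pin_ends_def)
  moreover have "x \<in> extensional {1..<n}" using x by (auto simp: space_PiM PiE_def)
  ultimately have "x = restrict (\<lambda>i. ?s i - ?s (i - 1)) {1..<n}"
    by (auto simp: fun_eq_iff restrict_def extensional_def)
  moreover have "height_profile n r p q ?s" using x by (simp add: profile_points_def)
  ultimately show "x \<in> ?lhs" by (intro CollectI exI[of _ ?s] conjI)
qed

text \<open>The translate of the order simplex by the vector of descent numbers, written as a
  preimage to suit \<open>lborel_on_translate\<close>. It is a cell of the arrangement of all
  hyperplanes \<open>x k = c\<close> and \<open>x k - x l = c\<close> with integers
  \<open>c\<close>.\<close>

definition alcove :: "nat \<Rightarrow> (nat \<Rightarrow> nat) \<Rightarrow> (nat \<Rightarrow> real) set" where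
  "alcove n \<tau> = (\<lambda>x. \<lambda>k\<in>{1..<n}. x k - real (descents \<tau> k)) -` order_simplex {1..<n} \<tau> \<inter>
     space (lborel_on {1..<n})"

lemma alcove_iff:
  "x \<in> alcove n \<tau> \<longleftrightarrow> x \<in> space (lborel_on {1..<n}) \<and>
     (\<forall>k\<in>{1..<n}. 0 < x k - descents \<tau> k \<and> x k - descents \<tau> k < 1) \<and>
     (\<forall>k\<in>{1..<n}. \<forall>l\<in>{1..<n}. \<tau> k < \<tau> l \<longrightarrow> x k - descents \<tau> k < x l - descents \<tau> l)"
  by (auto simp: alcove_def order_simplex_def space_PiM)

lemma alcove_measure:
  assumes "\<tau> permutes {1..<n}"
  shows "alcove n \<tau> \<in> sets (lborel_on {1..<n})"
    and "emeasure (lborel_on {1..<n}) (alcove n \<tau>) = ennreal (1 / fact (n - 1))"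
proof -
  let ?I = "{1..<n}"
  let ?R = "\<lambda>x. \<lambda>k\<in>?I. x k - real (descents \<tau> k)"
  have R: "?R \<in> lborel_on ?I \<rightarrow>\<^sub>M lborel_on ?I" by measurable
  then show "alcove n \<tau> \<in> sets (lborel_on ?I)"
    unfolding alcove_def by (rule measurable_sets) simp
  have "emeasure (lborel_on ?I) (alcove n \<tau>) = emeasure (distr (lborel_on ?I) (lborel_on ?I) ?R) (order_simplex ?I \<tau>)"
    unfolding alcove_def by (rule emeasure_distr[OF R, symmetric]) simp
  also have "\<dots> = ennreal (1 / fact (n - 1))"
    using lborel_on_translate[of ?I "\<lambda>k. real (descents \<tau> k)"] emeasure_order_simplex[OF assms] by simp
  finally show "emeasure (lborel_on ?I) (alcove n \<tau>) = ennreal (1 / fact (n - 1))" .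
qed

text \<open>On an alcove the descent number is the integer part of \<open>x k\<close>, so the order
  of the fractional parts gives \<open>\<tau>\<close> back.\<close>

lemma alcove_eq_rank_in:
  assumes "x \<in> alcove n \<tau>" "\<tau> permutes {1..<n}"
  shows "\<tau> = rank_in {1..<n} (\<lambda>k. frac (x k))"
proof (rule permutes_eq_rank_in[OF assms(2)])
  have "frac (x k) = x k - descents \<tau> k" if "k \<in> {1..<n}" for k
    using assms(1) that by (subst frac_unique_iff) (auto simp: alcove_iff less_imp_le)
  then show "frac (x k) < frac (x l)" if "k \<in> {1..<n}" "l \<in> {1..<n}" "\<tau> k < \<tau> l" for k l
    using assms(1) that by (simp add: alcove_iff)
qed

lemma alcove_subset_profile_points:
  assumes n: "2 \<le> n" and ends: "p 0 = 0" "q 0 = 0" "p n = r" "q n = r"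
    and \<tau>: "\<tau> \<in> admissible_perms n r p q"
  shows "alcove n \<tau> \<subseteq> profile_points n r p q"
proof
  fix x assume x: "x \<in> alcove n \<tau>"
  have perm: "\<tau> permutes {1..<n}" using \<tau> by (simp add: admissible_perms_def)
  define d where "d k = real (descents \<tau> k)" for k
  have t01: "0 < x k - d k" "x k - d k < 1" if "k \<in> {1..<n}" for k
    using x that by (auto simp: alcove_iff d_def)
  have t_less: "x k - d k < x l - d l" if "k \<in> {1..<n}" "l \<in> {1..<n}" "\<tau> k < \<tau> l" for k l
    using x that by (auto simp: alcove_iff d_def)
  have "height_profile n r p q (pin_ends n r x)"
    unfolding height_profile_def
  proof (intro conjI allI impI)
    show "pin_ends n r x 0 = 0" "pin_ends n r x n = real r" using n by (auto simp: pin_ends_def)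
    fix k assume k: "k < n"
    have "0 \<le> pin_ends n r x (Suc k) - pin_ends n r x k \<and> pin_ends n r x (Suc k) - pin_ends n r x k \<le> 1"
    proof -
      \<comment> \<open>As \<open>2 \<le> n\<close>, the first and the last step are different, so
        no step has both ends pinned.\<close>
      consider "k = 0" | "0 < k" "Suc k < n" | "0 < k" "Suc k = n" using k by linarith
      then show ?thesis
      proof cases
        case 1
        then show ?thesis using t01[of 1] n by (auto simp: pin_ends_def d_def descents_1)
      next
        case 2
        have "\<tau> (Suc k) \<noteq> \<tau> k" using permutes_inj[OF perm] by (metis injD n_not_Suc_n)
        then consider "\<tau> k < \<tau> (Suc k)" | "\<tau> (Suc k) < \<tau> k" by linarith
        then show ?thesis
        proof cases
          case 1
          then have "d (Suc k) = d k" using 2 by (simp add: d_def descents_Suc)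
          then show ?thesis using t_less[of k "Suc k"] t01[of k] t01[of "Suc k"] 1 2
            by (simp add: pin_ends_def)
        next
          case desc: 2
          then have "d (Suc k) = d k + 1" using 2 by (simp add: d_def descents_Suc)
          then show ?thesis using t_less[of "Suc k" k] t01[of k] t01[of "Suc k"] desc 2
            by (simp add: pin_ends_def)
        qed
      next
        case 3
        then have "Suc (descents \<tau> k) = r" using \<tau> by (auto simp: admissible_perms_def)
        then have "d k = real r - 1" by (auto simp: d_def)
        then show ?thesis using t01[of k] 3 by (simp add: pin_ends_def)
      qed
    qed
    then show "0 \<le> pin_ends n r x (Suc k) - pin_ends n r x k" "pin_ends n r x (Suc k) - pin_ends n r x k \<le> 1"
      by auto
  next
    fix k assume "k \<le> n"
    then consider "k = 0" | "k \<in> {1..<n}" | "k = n" by fastforce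
    then have "real (p k) \<le> pin_ends n r x k \<and> pin_ends n r x k \<le> real (q k)"
    proof cases
      case 2
      then have "p k \<le> descents \<tau> k" "Suc (descents \<tau> k) \<le> q k" using \<tau> by (auto simp: admissible_perms_def)
      then have "real (p k) \<le> d k" "d k + 1 \<le> real (q k)" unfolding d_def by linarith+
      then show ?thesis using t01[OF 2] 2 by (simp add: pin_ends_def)
    qed (use ends n in \<open>auto simp: pin_ends_def\<close>)
    then show "real (p k) \<le> pin_ends n r x k" "pin_ends n r x k \<le> real (q k)" by auto
  qed
  then show "x \<in> profile_points n r p q" using x by (simp add: profile_points_def alcove_iff)
qed

lemma profile_points_subset_alcoves:
  assumes n: "2 \<le> n" and x: "x \<in> profile_points n r p q" and generic: "x \<notin> fractional_ties {1..<n}"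
  shows "x \<in> (\<Union>\<tau>\<in>admissible_perms n r p q. alcove n \<tau>)"
proof -
  let ?I = "{1..<n}"
  define t where "t k = frac (x k)" for k
  define \<tau> where "\<tau> = rank_in ?I t"
  have xs: "x \<in> space (lborel_on ?I)" and H: "height_profile n r p q (pin_ends n r x)"
    using x by (auto simp: profile_points_def)
  have nonint: "x k \<notin> \<int>" if "k \<in> ?I" for k
    using generic xs that unfolding fractional_ties_def by blast
  have nontie: "x k - x l \<notin> \<int>" if "k \<in> ?I" "l \<in> ?I" "k \<noteq> l" for k l
    using generic xs that unfolding fractional_ties_def by blast
  have inj: "inj_on t ?I"
  proof (rule inj_onI, rule ccontr)
    fix k l assume kl: "k \<in> ?I" "l \<in> ?I" "t k = t l" "k \<noteq> l"
    then have "x k - x l = of_int (\<lfloor>x k\<rfloor> - \<lfloor>x l\<rfloor>)" by (simp add: t_def frac_def)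
    then show False using nontie[of k l] kl by (metis Ints_of_int)
  qed
  have perm: "\<tau> permutes ?I" unfolding \<tau>_def by (rule rank_in_permutes[OF inj])
  have \<tau>_less: "\<tau> k < \<tau> l \<longleftrightarrow> t k < t l" if "k \<in> ?I" "l \<in> ?I" for k l
    unfolding \<tau>_def by (rule rank_in_less_iff) (use that in auto)
  have t01: "0 < t k" "t k < 1" if "k \<in> ?I" for k
    using nonint[OF that] by (auto simp: t_def frac_lt_1 frac_gt_0_iff)
  have step: "0 \<le> pin_ends n r x (Suc k) - pin_ends n r x k \<and> pin_ends n r x (Suc k) - pin_ends n r x k \<le> 1"
    if "k < n" for k using H that by (auto simp: height_profile_def)
  \<comment> \<open>The induction starts at 0 because \<open>x 1\<close> lies in
    \<open>[0, 1]\<close> and is not an integer. Afterwards the absence of ties lets the integer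
    part rise exactly at the descents of \<open>\<tau>\<close>.\<close>
  have floor_x: "k < n \<Longrightarrow> \<lfloor>x k\<rfloor> = int (descents \<tau> k)" if "1 \<le> k" for k
    using that
  proof (induction k rule: nat_induct_at_least)
    case base
    have "0 \<le> x 1 \<and> x 1 \<le> 1" using step[of 0] n by (simp add: pin_ends_def)
    moreover have "x 1 \<noteq> 1" using nonint[of 1] n by auto
    ultimately have "\<lfloor>x 1\<rfloor> = 0" by linarith
    then show ?case by (simp add: descents_1)
  next
    case (Suc k)
    then have k: "k \<in> ?I" "Suc k \<in> ?I" by auto
    have "0 \<le> x (Suc k) - x k \<and> x (Suc k) - x k \<le> 1" using step[of k] k by (simp add: pin_ends_def)
    then have "(\<lfloor>x (Suc k)\<rfloor> = \<lfloor>x k\<rfloor> \<and> t k \<le> t (Suc k)) \<or> (\<lfloor>x (Suc k)\<rfloor> = \<lfloor>x k\<rfloor> + 1 \<and> t (Suc k) \<le> t k)"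
      unfolding t_def by (simp only: step_iff_floor_frac)
    moreover have "t k \<noteq> t (Suc k)" using inj k by (metis inj_onD n_not_Suc_n)
    ultimately show ?case using Suc \<tau>_less[OF k(2,1)] k by (auto simp: descents_Suc)
  qed
  have t_eq: "x k - descents \<tau> k = t k" if "k \<in> ?I" for k
    using floor_x[of k] that by (simp add: t_def frac_def)
  have "x \<in> alcove n \<tau>"
    unfolding alcove_iff using xs t01 \<tau>_less t_eq by simp
  moreover have "\<tau> \<in> admissible_perms n r p q"
    unfolding admissible_perms_def
  proof (intro CollectI conjI perm ballI)
    obtain l where l: "n = Suc l" "l \<in> ?I" using n by (cases n) auto
    have "0 \<le> real r - x l \<and> real r - x l \<le> 1" using step[of l] l by (simp add: pin_ends_def)
    moreover have "x l = real (descents \<tau> l) + t l" using t_eq[OF l(2)] by simp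
    \<comment> \<open>Strict because \<open>0 < t l < 1\<close>; between integers a single value
      remains. The bounds at \<open>k\<close> below are sharpened in the same way.\<close>
    ultimately have "real (descents \<tau> l) < real r" "real r < real (descents \<tau> l) + 2"
      using t01[OF l(2)] by linarith+
    then have "Suc (descents \<tau> l) = r" by linarith
    then show "Suc (descents \<tau> (n - 1)) = r" using l by simp
    fix k assume k: "k \<in> ?I"
    then have "real (p k) \<le> x k \<and> x k \<le> real (q k)"
      using H unfolding height_profile_def by (auto simp: pin_ends_def dest: spec[of _ k])
    moreover have "x k = real (descents \<tau> k) + t k" using t_eq[OF k] by simp
    ultimately have "real (p k) < real (descents \<tau> k) + 1" "real (descents \<tau> k) < real (q k)"
      using t01[OF k] by linarith+
    then show "p k \<le> descents \<tau> k" "Suc (descents \<tau> k) \<le> q k" by linarith+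
  qed
  ultimately show ?thesis by blast
qed

lemma emeasure_profile_points:
  assumes n: "2 \<le> n" and ends: "p 0 = 0" "q 0 = 0" "p n = r" "q n = r"
  shows "emeasure (lborel_on {1..<n}) (profile_points n r p q) =
    ennreal (card (admissible_perms n r p q) / fact (n - 1))"
proof -
  let ?I = "{1..<n}" and ?G = "admissible_perms n r p q" and ?A = "profile_points n r p q"
  have perm: "\<tau> permutes ?I" if "\<tau> \<in> ?G" for \<tau> using that by (simp add: admissible_perms_def)
  have fin: "finite ?G"
    by (rule finite_subset[OF _ finite_permutations[of ?I]]) (use perm in auto)
  have union: "(\<Union>\<tau>\<in>?G. alcove n \<tau>) \<in> sets (lborel_on ?I)"
    using fin perm alcove_measure(1) by (intro sets.finite_UN) auto
  have "?A = (\<Union>\<tau>\<in>?G. alcove n \<tau>) \<union> (?A \<inter> fractional_ties ?I)"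
    using alcove_subset_profile_points[OF n ends] profile_points_subset_alcoves[OF n] by blast
  then have "emeasure (lborel_on ?I) ?A = emeasure (lborel_on ?I) ((\<Union>\<tau>\<in>?G. alcove n \<tau>) \<union> (?A \<inter> fractional_ties ?I))"
    by simp
  also have "\<dots> = emeasure (lborel_on ?I) (\<Union>\<tau>\<in>?G. alcove n \<tau>)"
    using union profile_points_sets fractional_ties_null[of ?I]
    by (intro emeasure_Un_null_set null_set_Int1) auto
  also have "\<dots> = (\<Sum>\<tau>\<in>?G. emeasure (lborel_on ?I) (alcove n \<tau>))"
  proof (rule sum_emeasure[symmetric, OF _ _ fin])
    show "disjoint_family_on (alcove n) ?G"
      unfolding disjoint_family_on_def using alcove_eq_rank_in perm
      by (metis (no_types, lifting) disjoint_iff)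
  qed (use alcove_measure(1) perm in auto)
  also have "\<dots> = (\<Sum>\<tau>\<in>?G. ennreal (1 / fact (n - 1)))"
    by (rule sum.cong) (use alcove_measure(2) perm in auto)
  also have "\<dots> = ennreal (card ?G / fact (n - 1))"
    by (simp add: ennreal_of_nat_eq_real_of_nat ennreal_mult[symmetric])
  finally show ?thesis .
qed


subsection \<open>Border strips and tableaux\<close>

text \<open>Keeps the truncated subtraction in \<open>descent_strip\<close> exact.\<close>

lemma descents_le: "descents \<tau> (Suc k) \<le> k"
proof -
  have "descents \<tau> (Suc k) \<le> card {1..<Suc k}" unfolding descents_def by (rule card_mono) auto
  then show ?thesis by simp
qed

text \<open>Each move raises the coordinate sum by one. Hence a box of the strip knows its own
  index, which gives distinctness, and the heights alone determine the strip.\<close>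

lemma border_strip_nth:
  assumes p: "border_strip m r p" and k: "k < length p"
  shows "fst (p ! k) + snd (p ! k) = k"
  using k
proof (induction k)
  case 0
  then show ?case using p by (cases p) (auto simp: border_strip_def)
next
  case (Suc k)
  then have "p ! Suc k = map_prod Suc id (p ! k) \<or> p ! Suc k = map_prod id Suc (p ! k)"
    using p by (auto simp: border_strip_def)
  then show ?case using Suc by (cases "p ! k") auto
qed

lemma border_strip_nth_Suc:
  assumes p: "border_strip m r p" and k: "Suc k < length p"
  shows "(fst (p ! Suc k) = Suc (fst (p ! k)) \<and> snd (p ! Suc k) = snd (p ! k)) \<or>
    (fst (p ! Suc k) = fst (p ! k) \<and> snd (p ! Suc k) = Suc (snd (p ! k)))"
proof -
  have "p ! Suc k = map_prod Suc id (p ! k) \<or> p ! Suc k = map_prod id Suc (p ! k)"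
    using p k by (auto simp: border_strip_def)
  then show ?thesis by (cases "p ! k") auto
qed

lemma border_strip_mono:
  assumes p: "border_strip m r p" and "k \<le> l" "l < length p"
  shows "fst (p ! k) \<le> fst (p ! l) \<and> snd (p ! k) \<le> snd (p ! l)"
  using assms(2,3)
proof (induction l rule: dec_induct)
  case (step l)
  then show ?case using border_strip_nth_Suc[OF p step.prems] by auto
qed simp

lemma border_strip_distinct:
  assumes "border_strip m r p" shows "distinct p"
  unfolding distinct_conv_nth using border_strip_nth[OF assms] by metis

text \<open>Rows and columns of a strip are runs of consecutive boxes, so comparing neighbours
  suffices. An upper neighbour carries a smaller entry and a right neighbour a larger one: the
  descents of the entries read along the strip are its up-moves.\<close>

lemma border_strip_tableau_iff:
  assumes p: "border_strip m r p"
  shows "T \<in> standard_young_tableaux (set p) \<longleftrightarrow>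
    T \<in> extensional (set p) \<and> bij_betw T (set p) {1..length p} \<and>
    (\<forall>k. Suc k < length p \<longrightarrow> (T (p ! Suc k) < T (p ! k) \<longleftrightarrow> snd (p ! Suc k) = Suc (snd (p ! k))))"
    (is "_ \<longleftrightarrow> ?ext \<and> ?bij \<and> ?local")
proof
  assume T: "T \<in> standard_young_tableaux (set p)"
  have ?local
  proof (intro allI impI)
    fix k assume k: "Suc k < length p"
    obtain i j i' j' where ij: "p ! k = (i, j)" "p ! Suc k = (i', j')" by fastforce
    have mem: "(i, j) \<in> set p" "(i', j') \<in> set p" using k ij by (metis Suc_lessD nth_mem)+
    have row: "T (i, j) < T (i', j)" if "i < i'" "j' = j"
      using T mem that unfolding standard_young_tableaux_def by blast
    have col: "T (i, j') < T (i, j)" if "j < j'" "i' = i"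
      using T mem that unfolding standard_young_tableaux_def by blast
    show "T (p ! Suc k) < T (p ! k) \<longleftrightarrow> snd (p ! Suc k) = Suc (snd (p ! k))"
      using border_strip_nth_Suc[OF p k] row col by (auto simp: ij)
  qed
  moreover have "card (set p) = length p" by (rule distinct_card[OF border_strip_distinct[OF p]])
  ultimately show "?ext \<and> ?bij \<and> ?local"
    using T by (auto simp: standard_young_tableaux_def)
next
  assume A: "?ext \<and> ?bij \<and> ?local"
  \<comment> \<open>On a move to the right \<open>?local\<close> only excludes a descent;
    injectivity makes the increase strict.\<close>
  have neq: "T (p ! k) \<noteq> T (p ! l)" if "k < length p" "l < length p" "k \<noteq> l" for k l
    using A that border_strip_distinct[OF p]
    by (metis bij_betw_def inj_onD nth_eq_iff_index_eq nth_mem)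
  have row: "T (p ! k) < T (p ! l)" if "Suc k \<le> l" "l < length p" "snd (p ! k) = snd (p ! l)" for k l
    using that
  proof (induction l rule: dec_induct)
    case base
    then show ?case using A neq[of k "Suc k"] by (metis Suc_lessD linorder_neqE_nat n_not_Suc_n)
  next
    case (step l)
    \<comment> \<open>Coordinates never decrease along the strip, so every box between two boxes of
      one row stays in that row.\<close>
    have "snd (p ! k) \<le> snd (p ! l)" "snd (p ! l) \<le> snd (p ! Suc l)"
      using border_strip_mono[OF p, of k l] border_strip_mono[OF p, of l "Suc l"] step by auto
    then have eq: "snd (p ! k) = snd (p ! l)" "snd (p ! Suc l) = snd (p ! l)" using step.prems by auto
    have "T (p ! k) < T (p ! l)" using step eq by auto
    also have "T (p ! l) < T (p ! Suc l)"
      using A neq[of l "Suc l"] eq step.prems by (metis Suc_lessD linorder_neqE_nat n_not_Suc_n)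
    finally show ?case .
  qed
  have col: "T (p ! l) < T (p ! k)" if "Suc k \<le> l" "l < length p" "fst (p ! k) = fst (p ! l)" for k l
    using that
  proof (induction l rule: dec_induct)
    case base
    then show ?case using A border_strip_nth_Suc[OF p, of k] by auto
  next
    case (step l)
    have "fst (p ! k) \<le> fst (p ! l)" "fst (p ! l) \<le> fst (p ! Suc l)"
      using border_strip_mono[OF p, of k l] border_strip_mono[OF p, of l "Suc l"] step by auto
    then have eq: "fst (p ! k) = fst (p ! l)" "fst (p ! Suc l) = fst (p ! l)" using step.prems by auto
    have "T (p ! Suc l) < T (p ! l)"
      using A border_strip_nth_Suc[OF p, of l] eq step.prems by auto
    also have "T (p ! l) < T (p ! k)" using step eq by auto
    finally show ?case .
  qed
  have index: "i + j < length p \<and> p ! (i + j) = (i, j)" if "(i, j) \<in> set p" for i j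
    using that border_strip_nth[OF p] by (metis fst_conv in_set_conv_nth snd_conv)
  have "T (i, j) < T (i', j)" if "(i, j) \<in> set p" "(i', j) \<in> set p" "i < i'" for i i' j
    using row[of "i + j" "i' + j"] index[OF that(1)] index[OF that(2)] that(3) by simp
  moreover have "T (i, j') < T (i, j)" if "(i, j) \<in> set p" "(i, j') \<in> set p" "j < j'" for i j j'
    using col[of "i + j" "i + j'"] index[OF that(1)] index[OF that(2)] that(3) by simp
  moreover have "card (set p) = length p" by (rule distinct_card[OF border_strip_distinct[OF p]])
  ultimately show "T \<in> standard_young_tableaux (set p)"
    using A unfolding standard_young_tableaux_def by auto
qed

section \<open>Strips inside the region and the permutations that trace them\<close>

text \<open>The two corners on the middle antidiagonal decide; the other two follow because a path
  height grows by 0 or 1 per step. With \<open>k = i + j + 1\<close> and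
  \<open>j = descents \<tau> k\<close> this is the bound in \<open>admissible_perms\<close>.\<close>

lemma region_boxes_iff:
  assumes "length P = m + r" "Suc (i + j) < m + r"
  shows "(i, j) \<in> region_boxes P Q \<longleftrightarrow>
    height P (Suc (i + j)) \<le> j \<and> Suc j \<le> height Q (Suc (i + j))"
proof -
  have "(i, j) \<in> region_boxes P Q \<longleftrightarrow> (i, j) \<in> region_points P Q \<and> (Suc i, j) \<in> region_points P Q \<and>
      (i, Suc j) \<in> region_points P Q \<and> (Suc i, Suc j) \<in> region_points P Q"
    by (auto simp: region_boxes_def)
  also have "\<dots> \<longleftrightarrow> height P (Suc (i + j)) \<le> j \<and> Suc j \<le> height Q (Suc (i + j))"
    using height_Suc_bounds[of P "i + j"] height_Suc_bounds[of P "Suc (i + j)"]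
      height_Suc_bounds[of Q "i + j"] height_Suc_bounds[of Q "Suc (i + j)"] assms
    by (auto simp: region_points_iff)
  finally show ?thesis .
qed

text \<open>Boxes are numbered from 0 and positions of \<open>\<tau>\<close> from 1, so box
  \<open>k\<close> belongs to position \<open>k + 1\<close>. Its height is the integer part of
  \<open>s (k + 1)\<close> on the alcove of \<open>\<tau>\<close>.\<close>

definition descent_strip :: "nat \<Rightarrow> (nat \<Rightarrow> nat) \<Rightarrow> (nat \<times> nat) list" where
  "descent_strip n \<tau> = map (\<lambda>k. (k - descents \<tau> (Suc k), descents \<tau> (Suc k))) [0..<n - 1]"

lemma descent_strip_border_strip:
  assumes P: "length P = m + r" and n: "2 \<le> m + r"
    and \<tau>: "\<tau> \<in> admissible_perms (m + r) r (height P) (height Q)"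
  shows "descent_strip (m + r) \<tau> \<in> border_strips_in m r P Q"
proof -
  let ?n = "m + r" and ?p = "descent_strip (m + r) \<tau>"
  have len: "length ?p = ?n - 1" by (simp add: descent_strip_def)
  have nth: "?p ! k = (k - descents \<tau> (Suc k), descents \<tau> (Suc k))" if "k < ?n - 1" for k
    using that by (simp add: descent_strip_def)
  have "border_strip m r ?p"
    unfolding border_strip_def
  proof (intro conjI allI impI)
    assume ne: "?p \<noteq> []"
    show "hd ?p = (0, 0)" using ne nth[of 0] len n by (simp add: hd_conv_nth descents_1)
    have "last ?p = ?p ! (?n - 2)" using ne len by (simp add: last_conv_nth numeral_2_eq_2)
    also have "\<dots> = (?n - 2 - descents \<tau> (?n - 1), descents \<tau> (?n - 1))"
    proof -
      have "Suc (?n - 2) = ?n - 1" using n by simp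
      then show ?thesis using nth[of "?n - 2"] n by simp
    qed
    finally have last: "last ?p = (?n - 2 - descents \<tau> (?n - 1), descents \<tau> (?n - 1))" .
    \<comment> \<open>Together with \<open>Suc (descents \<tau> (?n - 1)) = r\<close>, the bound
      derived here rules out \<open>m = 0\<close>, so the truncated first coordinate of the last box
      is exactly \<open>m - 1\<close>.\<close>
    have "Suc (?n - 2) = ?n - 1" using n by simp
    then have "descents \<tau> (?n - 1) \<le> ?n - 2" by (metis descents_le)
    moreover have "Suc (descents \<tau> (?n - 1)) = r" using \<tau> by (simp add: admissible_perms_def)
    ultimately show "map_prod Suc Suc (last ?p) = (m, r)" unfolding last using n by auto
  next
    fix k assume k: "Suc k < length ?p"
    show "?p ! Suc k = map_prod Suc id (?p ! k) \<or> ?p ! Suc k = map_prod id Suc (?p ! k)"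
      using nth[of k] nth[of "Suc k"] k len descents_le[of \<tau> k] by (auto simp: descents_Suc Suc_diff_le)
  qed (rule len)
  moreover have "set ?p \<subseteq> region_boxes P Q"
  proof
    fix b assume "b \<in> set ?p"
    then obtain k where k: "k < ?n - 1" "b = (k - descents \<tau> (Suc k), descents \<tau> (Suc k))"
      using len nth by (metis in_set_conv_nth)
    have "k - descents \<tau> (Suc k) + descents \<tau> (Suc k) = k" using descents_le[of \<tau> k] by simp
    then show "b \<in> region_boxes P Q"
      using \<tau> k(1) unfolding k(2) by (subst region_boxes_iff[OF P]) (auto simp: admissible_perms_def)
  qed
  ultimately show ?thesis by (simp add: border_strips_in_def)
qed

text \<open>\<open>F\<close> reads a tableau along the strip and \<open>H\<close> writes a
  permutation into the boxes. They are inverse to each other, and \<open>F T\<close> traces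
  \<open>p\<close> again because its descents are the up-moves of \<open>p\<close>.\<close>

lemma card_tableaux_eq_card_perms:
  assumes P: "length P = m + r" and n: "2 \<le> m + r" and p: "p \<in> border_strips_in m r P Q"
  shows "card (standard_young_tableaux (set p)) =
    card {\<tau> \<in> admissible_perms (m + r) r (height P) (height Q). descent_strip (m + r) \<tau> = p}"
    (is "card ?Y = card ?G")
proof -
  let ?n = "m + r" and ?I = "{1..<m + r}"
  have strip: "border_strip m r p" and boxes: "set p \<subseteq> region_boxes P Q"
    using p by (auto simp: border_strips_in_def)
  then have len: "length p = ?n - 1" by (simp add: border_strip_def)
  have sum_nth: "fst (p ! k) + snd (p ! k) = k" if "k < ?n - 1" for k
    using border_strip_nth[OF strip] that len by simp
  have bij_p: "bij_betw (\<lambda>k. p ! (k - 1)) ?I (set p)"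
  proof -
    have "bij_betw (\<lambda>k. k - 1) ?I {..<length p}"
      by (rule bij_betw_byWitness[where f' = Suc]) (auto simp: len)
    moreover have "bij_betw ((!) p) {..<length p} (set p)"
      by (rule bij_betw_nth[OF border_strip_distinct[OF strip]]) auto
    ultimately show ?thesis using bij_betw_trans[of "\<lambda>k. k - 1" ?I _ "(!) p"] by (simp add: o_def)
  qed
  define F where "F T = (\<lambda>k. if k \<in> ?I then T (p ! (k - 1)) else k)" for T :: "nat \<times> nat \<Rightarrow> nat"
  \<comment> \<open>A box \<open>b\<close> of the strip has index \<open>fst b + snd b\<close>,
    hence position one larger. Restriction to \<open>set p\<close> makes the filling
    extensional.\<close>
  define H where "H \<tau> = (\<lambda>b\<in>set p. \<tau> (Suc (fst b + snd b)))" for \<tau> :: "nat \<Rightarrow> nat"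
  have I_eq: "?I = {1..length p}" using len n by auto
  have F_G: "F T \<in> ?G" if T: "T \<in> ?Y" for T
  proof -
    have bij: "bij_betw T (set p) ?I" and
      loc: "\<And>k. Suc k < length p \<Longrightarrow> T (p ! Suc k) < T (p ! k) \<longleftrightarrow> snd (p ! Suc k) = Suc (snd (p ! k))"
      using T unfolding border_strip_tableau_iff[OF strip] I_eq by blast+
    have "bij_betw (F T) ?I ?I"
      using bij_betw_trans[OF bij_p bij] by (rule bij_betw_cong[THEN iffD1, rotated]) (simp add: F_def)
    then have perm: "F T permutes ?I" by (rule bij_imp_permutes) (simp only: F_def if_False)
    have desc: "descents (F T) (Suc k) = snd (p ! k)" if "k < ?n - 1" for k
      using that
    proof (induction k)
      case 0
      then show ?case using strip len by (cases p) (auto simp: border_strip_def descents_1)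
    next
      case (Suc k)
      have "F T (Suc (Suc k)) = T (p ! Suc k)" "F T (Suc k) = T (p ! k)" using Suc.prems by (auto simp: F_def)
      then show ?case using Suc loc[of k] border_strip_nth_Suc[OF strip, of k] len
        by (auto simp: descents_Suc)
    qed
    have "descent_strip ?n (F T) = p"
    proof (rule nth_equalityI)
      show "length (descent_strip ?n (F T)) = length p" by (simp add: descent_strip_def len)
      fix k assume "k < length (descent_strip ?n (F T))"
      then have k: "k < ?n - 1" by (simp add: descent_strip_def)
      then have "descent_strip ?n (F T) ! k = (k - snd (p ! k), snd (p ! k))"
        by (simp add: descent_strip_def desc)
      also have "\<dots> = p ! k" using sum_nth[OF k] by (metis diff_add_inverse2 prod.collapse)
      finally show "descent_strip ?n (F T) ! k = p ! k" .
    qed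
    moreover have "F T \<in> admissible_perms ?n r (height P) (height Q)"
      unfolding admissible_perms_def
    proof (intro CollectI conjI perm ballI)
      have "p \<noteq> []" using len n by auto
      then have "Suc (snd (last p)) = r" using strip by (cases "last p") (auto simp: border_strip_def)
      moreover have "last p = p ! (?n - 2)" using \<open>p \<noteq> []\<close> len by (simp add: last_conv_nth numeral_2_eq_2)
      moreover have "Suc (?n - 2) = ?n - 1" using n by simp
      ultimately show "Suc (descents (F T) (?n - 1)) = r" using desc[of "?n - 2"] n by simp
      fix k assume k: "k \<in> ?I"
      then obtain l where l: "k = Suc l" "l < ?n - 1" by (cases k) auto
      have "p ! l \<in> region_boxes P Q" using boxes l len by auto
      then have "height P (Suc l) \<le> snd (p ! l) \<and> Suc (snd (p ! l)) \<le> height Q (Suc l)"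
        using region_boxes_iff[OF P, of "fst (p ! l)" "snd (p ! l)"] sum_nth[OF l(2)] l by simp
      then show "height P k \<le> descents (F T) k" "Suc (descents (F T) k) \<le> height Q k"
        using desc[OF l(2)] l by auto
    qed
    ultimately show ?thesis by simp
  qed
  have H_Y: "H \<tau> \<in> ?Y" if \<tau>: "\<tau> \<in> ?G" for \<tau>
    unfolding border_strip_tableau_iff[OF strip]
  proof (intro conjI allI impI)
    have perm: "\<tau> permutes ?I" using \<tau> by (simp add: admissible_perms_def)
    have H_nth: "H \<tau> (p ! k) = \<tau> (Suc k)" if "k < ?n - 1" for k
      using that sum_nth[OF that] len by (simp add: H_def)
    show "H \<tau> \<in> extensional (set p)" by (simp add: H_def)
    have "bij_betw (H \<tau>) (set p) ?I"
    proof -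
      have "bij_betw (H \<tau> \<circ> (\<lambda>k. p ! (k - 1))) ?I ?I"
      proof (rule bij_betw_cong[THEN iffD1, rotated])
        show "bij_betw \<tau> ?I ?I" by (rule permutes_imp_bij[OF perm])
        fix k assume "k \<in> ?I"
        then show "\<tau> k = (H \<tau> \<circ> (\<lambda>k. p ! (k - 1))) k" using H_nth[of "k - 1"] by auto
      qed
      then show ?thesis using bij_betw_comp_iff[OF bij_p] by blast
    qed
    then show "bij_betw (H \<tau>) (set p) {1..length p}" by (simp only: I_eq)
    fix k assume k: "Suc k < length p"
    have nth: "p ! l = (l - descents \<tau> (Suc l), descents \<tau> (Suc l))" if "l < ?n - 1" for l
    proof -
      have "p = descent_strip ?n \<tau>" using \<tau> by simp
      then show ?thesis using that by (simp add: descent_strip_def)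
    qed
    show "H \<tau> (p ! Suc k) < H \<tau> (p ! k) \<longleftrightarrow> snd (p ! Suc k) = Suc (snd (p ! k))"
      using k len nth[of k] nth[of "Suc k"] H_nth[of k] H_nth[of "Suc k"] by (auto simp: descents_Suc)
  qed
  have "bij_betw F ?Y ?G"
  proof (rule bij_betw_byWitness[where f' = H])
    show "\<forall>T\<in>?Y. H (F T) = T"
    proof (intro ballI ext)
      fix T b assume T: "T \<in> ?Y"
      show "H (F T) b = T b"
      proof (cases "b \<in> set p")
        case True
        then obtain k where k: "k < ?n - 1" "b = p ! k" using len by (metis in_set_conv_nth)
        then show ?thesis using True sum_nth[OF k(1)] by (auto simp: H_def F_def)
      next
        case False
        then show ?thesis using T by (cases b) (simp add: H_def standard_young_tableaux_def extensional_def)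
      qed
    qed
    show "\<forall>\<tau>\<in>?G. F (H \<tau>) = \<tau>"
    proof (intro ballI ext)
      fix \<tau> k assume "\<tau> \<in> ?G"
      then have perm: "\<tau> permutes ?I" by (simp add: admissible_perms_def)
      show "F (H \<tau>) k = \<tau> k"
      proof (cases "k \<in> ?I")
        case True
        then have "k - 1 < ?n - 1" by auto
        then show ?thesis using True sum_nth[of "k - 1"] len by (auto simp: H_def F_def)
      next
        case False
        then show ?thesis using permutes_not_in[OF perm False] by (simp only: F_def if_False)
      qed
    qed
  qed (use F_G H_Y in auto)
  then show ?thesis by (rule bij_betw_same_card)
qed

lemma finite_border_strips_in: "finite (border_strips_in m r P Q)"
proof -
  have "region_boxes P Q \<subseteq> {..length P} \<times> {..length P}"
    by (auto simp: region_boxes_def region_points_def)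
  then have "finite (region_boxes P Q)" by (rule finite_subset) simp
  then have "finite {p. set p \<subseteq> region_boxes P Q \<and> length p = m + r - 1}" by (rule finite_lists_length_eq)
  then show ?thesis by (rule rev_finite_subset) (auto simp: border_strips_in_def border_strip_def)
qed

text \<open>Each admissible permutation traces one strip of the region, and the permutations over a
  strip are counted by its tableaux.\<close>

lemma sum_tableaux_eq_card_perms:
  assumes P: "length P = m + r" and n: "2 \<le> m + r"
  shows "(\<Sum>p\<in>border_strips_in m r P Q. card (standard_young_tableaux (set p))) =
    card (admissible_perms (m + r) r (height P) (height Q))"
proof -
  let ?G = "admissible_perms (m + r) r (height P) (height Q)"
  have fin: "finite ?G"
    by (rule finite_subset[OF _ finite_permutations[of "{1..<m + r}"]]) (auto simp: admissible_perms_def)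
  have "card ?G = (\<Sum>\<tau>\<in>?G. 1)" by simp
  also have "\<dots> = (\<Sum>p\<in>border_strips_in m r P Q. \<Sum>\<tau>\<in>{\<tau>\<in>?G. descent_strip (m + r) \<tau> = p}. 1)"
    by (rule sum.group[symmetric, OF fin finite_border_strips_in])
       (use descent_strip_border_strip[OF P n] in blast)
  also have "\<dots> = (\<Sum>p\<in>border_strips_in m r P Q. card (standard_young_tableaux (set p)))"
    by (rule sum.cong) (simp_all add: card_tableaux_eq_card_perms[OF P n])
  finally show ?thesis by simp
qed

section \<open>The volume as a count of permutations, and the zero-dimensional case\<close>

lemma normalized_volume_lattice_path_polytope:
  assumes P: "lattice_path m r P" and Q: "lattice_path m r Q" and n: "2 \<le> m + r"
  shows "normalized_volume (m + r) (matroid_polytope (lattice_path_matroid m r P Q)) =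
    real (card (admissible_perms (m + r) r (height P) (height Q)))"
proof -
  let ?n = "m + r" and ?p = "height P" and ?q = "height Q"
  have "emeasure (lborel_on {1..<?n})
      ((\<lambda>x. restrict (Poly_Mapping.lookup x) {1..<?n}) ` matroid_polytope (lattice_path_matroid m r P Q)) =
    emeasure (lborel_on {1..<?n}) (profile_points ?n r ?p ?q)"
    unfolding matroid_polytope_image[OF P]
    using n by (subst increments_eq_vimage_partial_sums)
      (auto intro!: emeasure_partial_sums_vimage[simplified] profile_points_sets[simplified])
  also have "\<dots> = ennreal (card (admissible_perms ?n r ?p ?q) / fact (?n - 1))"
    by (rule emeasure_profile_points[OF n]) (simp_all add: height_0 height_end P Q)
  finally show ?thesis
    unfolding normalized_volume_def measure_def by simp
qed

lemma small_lattice_path_unique: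
  assumes "lattice_path m r P" "lattice_path m r Q" "m + r \<le> 1"
  shows "P = Q"
proof -
  have "length P = m + r" "length Q = m + r" using assms lattice_path_length by blast+
  then show ?thesis
  proof (cases P)
    case (Cons a P')
    then obtain b Q' where "Q = b # Q'" using \<open>length P = m + r\<close> \<open>length Q = m + r\<close> by (cases Q) auto
    moreover have "P' = []" "Q' = []"
      using Cons calculation \<open>length P = m + r\<close> \<open>length Q = m + r\<close> assms(3)
      by (simp_all flip: length_0_conv)
    ultimately show ?thesis using Cons assms by (cases a; cases b) (auto simp: lattice_path_def)
  qed simp
qed

text \<open>The product over the empty index set is a single point of measure 1, and the projected
  polytope contains it because \<open>height P\<close> itself is a profile.\<close>

lemma normalized_volume_small:
  assumes P: "lattice_path m r P" and n: "m + r \<le> 1"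
  shows "normalized_volume (m + r) (matroid_polytope (lattice_path_matroid m r P P)) = 1"
proof -
  let ?B = "{i\<in>{1..m + r}. r = 1}"
  have I: "{1..<m + r} = {}" using n by auto
  have "height_profile (m + r) r (height P) (height P) (\<lambda>k. height P k)"
    using height_Suc_bounds[of P] by (auto simp: height_profile_def height_0 height_end[OF P])
      (metis diff_le_eq le_add_diff_inverse of_nat_Suc of_nat_le_iff add.commute)
  then have "(\<lambda>x. restrict (Poly_Mapping.lookup x) {1..<m + r}) `
      matroid_polytope (lattice_path_matroid m r P P) = {\<lambda>_. undefined}"
    unfolding matroid_polytope_image[OF P] unfolding I by (auto simp: restrict_def)
  moreover have "fact (m + r - 1) = (1 :: real)" using n by simp
  ultimately show ?thesis
    unfolding normalized_volume_def I by (simp add: PiM_empty measure_def)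
qed

theorem mainTheorem10:
  fixes m r :: nat and P Q :: "step list"
  assumes "lattice_path m r P" and "lattice_path m r Q"
    and "never_above P Q"
    and "matroid_connected (lattice_path_matroid m r P Q)"
    and "\<not> border_strip_matroid m r P Q"
  shows "normalized_volume (m + r) (matroid_polytope (lattice_path_matroid m r P Q)) =
    real (\<Sum>p \<in> border_strips_in m r P Q. card (standard_young_tableaux (set p)))"
proof (cases "m + r \<le> 1")
  case True
  \<comment> \<open>Length 0 leaves only the empty strip; its one empty tableau makes the sum equal
    to 1.\<close>
  then have "border_strips_in m r P Q = {[]}"
    by (auto simp: border_strips_in_def border_strip_def)
  moreover have "standard_young_tableaux {} = {\<lambda>_. undefined}"
    by (auto simp: standard_young_tableaux_def bij_betw_def)
  moreover have "Q = P" using small_lattice_path_unique assms(1,2) True by blast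
  ultimately show ?thesis using normalized_volume_small[OF assms(1) True] by simp
next
  case False
  then show ?thesis
    using normalized_volume_lattice_path_polytope[OF assms(1,2)]
      sum_tableaux_eq_card_perms[OF lattice_path_length[OF assms(1)]] by simp
qed

end
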